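(* Let $n\ge 1$ and let $P_1(z)=a_nz^n+a_{n-1}z^{n-1}+\cdots+a_0$ and $P_0(z)=b_nz^n+b_{n-1}z^{n-1}+\cdots+b_0$ be non-constant polynomials with complex coefficients, $a_n\neq 0$, $b_n\neq 0$. Let $h_1$ and $h_0$ be entire functions, not identically zero, satisfying $\rho(h_1)<\deg P_1$ and $\rho(h_0)<\deg P_0$. Suppose that $P_1(z)-cP_0(z)$ is a constant for some real $c\geq 1$, that $h_1$ has Fabry gaps, and that $\mu(h_0)>\rho(h_1)$. Then every non-constant solution $f$ of the differential equation $$f''+h_1(z)e^{P_1(z)}f'+h_0(z)e^{P_0(z)}f=0$$ has infinite order.
   Context: All solutions of this equation are entire functions. For an entire function $g$, with $M(r,g)=\max_{|z|=r}|g(z)|$, the order is $\rho(g)=\limsup_{r\to\infty}\frac{\log^+\log^+ M(r,g)}{\log r}$ and the lower order is $\mu(g)=\liminf_{r\to\infty}\frac{\log^+\log^+ M(r,g)}{\log r}$. An entire function $g(z)=\sum_{n=0}^\infty a_{\lambda_n}z^{\lambda_n}$ (with $\lambda_n$ increasing) is said to have Fabry gaps if $\lambda_n/n\to\infty$ as $n\to\infty$. *)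

theory Defs
  imports "HOL-Complex_Analysis.Complex_Analysis" "HOL-Computational_Algebra.Polynomial"
begin

definition logp :: "real \<Rightarrow> real" where
  "logp x = (if x \<le> 1 then 0 else ln x)"

definition max_mod :: "real \<Rightarrow> (complex \<Rightarrow> complex) \<Rightarrow> real" where
  "max_mod r g = Sup ((\<lambda>z. norm (g z)) ` sphere 0 r)"

definition ent_order :: "(complex \<Rightarrow> complex) \<Rightarrow> ereal" where
  "ent_order g = Limsup at_top (\<lambda>r::real. ereal (logp (logp (max_mod r g)) / ln r))"

definition ent_lower_order :: "(complex \<Rightarrow> complex) \<Rightarrow> ereal" where
  "ent_lower_order g = Liminf at_top (\<lambda>r::real. ereal (logp (logp (max_mod r g)) / ln r))"

definition fabry_gaps :: "(complex \<Rightarrow> complex) \<Rightarrow> bool" where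
  "fabry_gaps g \<longleftrightarrow> (\<exists>lam::nat \<Rightarrow> nat. strict_mono lam \<and>
     (\<forall>k. (deriv ^^ k) g 0 \<noteq> 0 \<longrightarrow> k \<in> range lam) \<and>
     filterlim (\<lambda>n. real (lam n) / real n) at_top sequentially)"

end

theory Submission
  imports Defs "HOL-Real_Asymp.Real_Asymp"
begin

text \<open>
  Suppose that \<open>f\<close> has finite order. Away from small discs about the zeros of \<open>f\<close>, \<open>f'\<close> and
  \<open>h\<^sub>1\<close>, the logarithmic derivatives of \<open>f\<close> are polynomially bounded and \<open>h\<^sub>1\<close> is bounded
  below by \<open>exp (- r\<^sup>\<sigma>)\<close> with \<open>\<sigma> < n\<close>. By Borel--Cantelli a dense set of rays eventually
  avoids these discs.

  If \<open>c = 1\<close>, dividing the equation by \<open>exp (P\<^sub>0) f\<close> on such rays with \<open>Re P\<^sub>0 > 0\<close> bounds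
  \<open>h\<^sub>0\<close> by \<open>h\<^sub>1\<close> up to factors of growth \<open>exp (r\<^sup>\<epsilon>)\<close>. These rays bound sectors of opening
  barely above \<open>\<pi> / n\<close>, and \<open>h\<^sub>0\<close> has order less than \<open>n\<close>, so Phragmen--Lindelof gives
  \<open>\<rho>(h\<^sub>0) \<le> \<rho>(h\<^sub>1)\<close>, a contradiction.

  If \<open>c > 1\<close>, then on rays with \<open>Re P\<^sub>0 > 0\<close> the term with \<open>f'\<close> dominates, so \<open>f' / f\<close> and
  \<open>f'' / f\<close> are exponentially small, while on rays with \<open>Re P\<^sub>0 < 0\<close> both coefficients are
  exponentially small; in either case \<open>f\<close> grows at most polynomially on the ray.
  Phragmen--Lindelof in thin sectors shows that \<open>f\<close> has order at most \<open>1/2\<close>. But then \<open>f / f'\<close>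
  is at most \<open>exp (r\<^sup>\<sigma>)\<close> with \<open>\<sigma> < n\<close> on a ray where \<open>f' / f\<close> decays like \<open>exp (- \<eta> r\<^sup>n)\<close>.
\<close>

section \<open>Exponential growth and decay along a filter\<close>

definition at_infinity_ray :: "real \<Rightarrow> complex filter" where
  "at_infinity_ray \<theta> = filtermap (\<lambda>t. rcis t \<theta>) at_top"

definition exp_bounded ::
  "real \<Rightarrow> 'a::real_normed_vector filter \<Rightarrow> ('a \<Rightarrow> 'b::real_normed_vector) \<Rightarrow> bool"
  where "exp_bounded s F u \<longleftrightarrow> (\<exists>K. \<forall>\<^sub>F z in F. norm (u z) \<le> exp (K * norm z powr s))"

definition exp_small ::
  "real \<Rightarrow> 'a::real_normed_vector filter \<Rightarrow> ('a \<Rightarrow> 'b::real_normed_vector) \<Rightarrow> bool"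
  where "exp_small s F u \<longleftrightarrow> (\<exists>\<eta>>0. \<forall>\<^sub>F z in F. norm (u z) \<le> exp (- \<eta> * norm z powr s))"

lemma eventually_at_infinity_ray:
  "eventually P (at_infinity_ray \<theta>) \<longleftrightarrow> (\<forall>\<^sub>F t in at_top. P (rcis t \<theta>))"
  by (simp add: at_infinity_ray_def eventually_filtermap)

lemma at_infinity_ray_neq_bot [simp]: "at_infinity_ray \<theta> \<noteq> bot"
  by (simp add: at_infinity_ray_def filtermap_bot_iff)

lemma at_infinity_ray_le_at_infinity: "at_infinity_ray \<theta> \<le> at_infinity"
proof -
  have "filterlim (\<lambda>t. norm (rcis t \<theta>)) at_top at_top"
    using filterlim_abs_real by simp
  then show ?thesis
    by (simp add: at_infinity_ray_def filterlim_def[symmetric]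
      filterlim_at_infinity_conv_norm_at_top)
qed

lemma eventually_norm_at_infinity:
  assumes "F \<le> at_infinity" "eventually P at_top"
  shows "\<forall>\<^sub>F z in F. P (norm z)"
  using filterlim_norm_at_top assms filter_leD by (metis eventually_compose_filterlim)

lemma eventually_affine_powr_le_powr:
  fixes A B s s' \<delta> :: real
  assumes "s < s'" "0 < s'" "\<delta> > 0"
  shows "\<forall>\<^sub>F t in at_top. A + B * t powr s \<le> \<delta> * t powr s'"
proof -
  have "((\<lambda>t. A * t powr (- s') + B * t powr (s - s')) \<longlongrightarrow> A * 0 + B * 0) at_top"
    using assms by (intro tendsto_intros tendsto_neg_powr filterlim_ident) auto
  then have "\<forall>\<^sub>F t in at_top. A * t powr (- s') + B * t powr (s - s') < \<delta>"
    by (rule order_tendstoD) (use assms in simp)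
  then show ?thesis using eventually_gt_at_top[of 0]
  proof eventually_elim
    case (elim t)
    have "A + B * t powr s = (A * t powr (- s') + B * t powr (s - s')) * t powr s'"
      using elim by (simp add: algebra_simps powr_add[symmetric])
    also have "\<dots> \<le> \<delta> * t powr s'" using elim by (intro mult_right_mono) auto
    finally show ?case .
  qed
qed

lemma exp_boundedE:
  assumes "exp_bounded s F u"
  obtains K where "K > 0" "\<forall>\<^sub>F z in F. norm (u z) \<le> exp (K * norm z powr s)"
proof -
  obtain K where "\<forall>\<^sub>F z in F. norm (u z) \<le> exp (K * norm z powr s)"
    using assms unfolding exp_bounded_def by blast
  then have "\<forall>\<^sub>F z in F. norm (u z) \<le> exp (max K 1 * norm z powr s)"
  proof eventually_elim
    case (elim z)
    also have "exp (K * norm z powr s) \<le> exp (max K 1 * norm z powr s)"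
      by (simp add: mult_right_mono)
    finally show ?case .
  qed
  then show ?thesis using that[of "max K 1"] by simp
qed

lemma exp_bounded_filter_mono: "exp_bounded s G u \<Longrightarrow> F \<le> G \<Longrightarrow> exp_bounded s F u"
  unfolding exp_bounded_def using filter_leD by blast

lemma exp_bounded_transform_eventually:
  assumes "exp_bounded s F u" "\<forall>\<^sub>F z in F. norm (u z) = norm (v z)"
  shows "exp_bounded s F v"
proof -
  obtain K where "\<forall>\<^sub>F z in F. norm (u z) \<le> exp (K * norm z powr s)"
    using assms(1) unfolding exp_bounded_def by blast
  with assms(2) have "\<forall>\<^sub>F z in F. norm (v z) \<le> exp (K * norm z powr s)"
    by eventually_elim simp
  then show ?thesis unfolding exp_bounded_def by blast
qed

lemma exp_small_transform_eventually:
  assumes "exp_small s F u" "\<forall>\<^sub>F z in F. norm (u z) = norm (v z)"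
  shows "exp_small s F v"
proof -
  obtain \<eta> where rate_pos: "\<eta> > 0" and u_le: "\<forall>\<^sub>F z in F. norm (u z) \<le> exp (- \<eta> * norm z powr s)"
    using assms(1) unfolding exp_small_def by blast
  from assms(2) u_le have "\<forall>\<^sub>F z in F. norm (v z) \<le> exp (- \<eta> * norm z powr s)"
    by eventually_elim simp
  with rate_pos show ?thesis unfolding exp_small_def by blast
qed

lemma exp_bounded_minus_iff [simp]: "exp_bounded s F (\<lambda>z. - u z) \<longleftrightarrow> exp_bounded s F u"
  by (simp add: exp_bounded_def)

lemma exp_small_zero: "exp_small s F (\<lambda>z. 0)"
  unfolding exp_small_def by (auto intro!: exI[of _ 1])

lemma exp_bounded_mult:
  fixes u v :: "'a::real_normed_vector \<Rightarrow> 'b::real_normed_algebra"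
  assumes "exp_bounded s F u" "exp_bounded s F v"
  shows "exp_bounded s F (\<lambda>z. u z * v z)"
proof -
  obtain K L where "\<forall>\<^sub>F z in F. norm (u z) \<le> exp (K * norm z powr s)"
    "\<forall>\<^sub>F z in F. norm (v z) \<le> exp (L * norm z powr s)"
    using assms unfolding exp_bounded_def by blast
  then have "\<forall>\<^sub>F z in F. norm (u z * v z) \<le> exp ((K + L) * norm z powr s)"
  proof eventually_elim
    case (elim z)
    have "norm (u z * v z) \<le> exp (K * norm z powr s) * exp (L * norm z powr s)"
      using elim by (intro order_trans[OF norm_mult_ineq] mult_mono) auto
    then show ?case by (simp add: exp_add[symmetric] algebra_simps)
  qed
  then show ?thesis unfolding exp_bounded_def by blast
qed

context
  fixes F :: "'a::real_normed_vector filter"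
  assumes F_le: "F \<le> at_infinity"
begin

lemma exp_bounded_of_power_bound:
  assumes "\<forall>\<^sub>F z in F. norm (u z) \<le> C * norm z ^ m" "s > 0"
  shows "exp_bounded s F u"
proof -
  have "\<forall>\<^sub>F t in at_top. C * t ^ m \<le> exp (t powr s)"
    using \<open>s > 0\<close> by real_asymp
  then have "\<forall>\<^sub>F z in F. C * norm z ^ m \<le> exp (norm z powr s)"
    by (rule eventually_norm_at_infinity[OF F_le])
  with assms(1) have "\<forall>\<^sub>F z in F. norm (u z) \<le> exp (1 * norm z powr s)"
    by eventually_elim simp
  then show ?thesis unfolding exp_bounded_def by blast
qed

lemma exp_bounded_of_bounded:
  assumes "\<forall>\<^sub>F z in F. norm (u z) \<le> C" "s > 0"
  shows "exp_bounded s F u"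
  by (rule exp_bounded_of_power_bound[where C = C and m = 0]) (use assms in simp_all)

lemma exp_bounded_add:
  fixes u v :: "'a \<Rightarrow> 'b::real_normed_vector"
  assumes "exp_bounded s F u" "exp_bounded s F v" "s > 0"
  shows "exp_bounded s F (\<lambda>z. u z + v z)"
proof -
  obtain K L where bounds: "\<forall>\<^sub>F z in F. norm (u z) \<le> exp (K * norm z powr s)"
    "\<forall>\<^sub>F z in F. norm (v z) \<le> exp (L * norm z powr s)"
    using assms unfolding exp_bounded_def by blast
  define M where "M = max K L + 1"
  have "\<forall>\<^sub>F t in at_top. exp (K * t powr s) + exp (L * t powr s) \<le> exp (M * t powr s)"
    using eventually_ge_at_top[of 1]
  proof eventually_elim
    case (elim t)
    have exp_ge_2: "2 \<le> exp (t powr s)"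
      using exp_ge_add_one_self[of "t powr s"] ge_one_powr_ge_zero[OF elim, of s] \<open>s > 0\<close>
      by linarith
    have "exp (K * t powr s) + exp (L * t powr s) \<le> 2 * exp (max K L * t powr s)"
      by (simp add: max_def mult_right_mono)
    also have "\<dots> \<le> exp (t powr s) * exp (max K L * t powr s)"
      using exp_ge_2 by (intro mult_right_mono) auto
    finally show ?case by (simp add: M_def exp_add[symmetric] algebra_simps)
  qed
  from eventually_norm_at_infinity[OF F_le this] bounds
  have "\<forall>\<^sub>F z in F. norm (u z + v z) \<le> exp (M * norm z powr s)"
    by eventually_elim (meson add_mono norm_triangle_le order_trans)
  then show ?thesis unfolding exp_bounded_def by blast
qed

lemma exp_bounded_exponent_mono:
  assumes "exp_bounded s F u" "s \<le> s'"
  shows "exp_bounded s' F u"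
proof -
  obtain K where bound: "K > 0" "\<forall>\<^sub>F z in F. norm (u z) \<le> exp (K * norm z powr s)"
    using exp_boundedE[OF assms(1)] .
  from eventually_norm_at_infinity[OF F_le eventually_ge_at_top[of 1]] bound(2)
  have "\<forall>\<^sub>F z in F. norm (u z) \<le> exp (K * norm z powr s')"
  proof eventually_elim
    case (elim z)
    have "K * norm z powr s \<le> K * norm z powr s'"
      using bound(1) elim assms(2) by (simp add: powr_mono)
    then show ?case using elim(2) by (meson exp_le_cancel_iff order_trans)
  qed
  then show ?thesis unfolding exp_bounded_def by blast
qed

lemma exp_small_mult_exp_bounded:
  fixes u v :: "'a \<Rightarrow> 'b::real_normed_algebra"
  assumes "exp_small s F u" "exp_bounded s' F v" "s' < s" "0 < s"
  shows "exp_small s F (\<lambda>z. u z * v z)"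
proof -
  obtain \<eta> K where rate_pos: "\<eta> > 0" and u_le: "\<forall>\<^sub>F z in F. norm (u z) \<le> exp (- \<eta> * norm z powr s)"
    and v_le: "\<forall>\<^sub>F z in F. norm (v z) \<le> exp (K * norm z powr s')"
    using assms unfolding exp_small_def exp_bounded_def by blast
  have "\<forall>\<^sub>F t in at_top. 0 + K * t powr s' \<le> \<eta> / 2 * t powr s"
    by (rule eventually_affine_powr_le_powr) (use assms rate_pos in auto)
  from eventually_norm_at_infinity[OF F_le this] u_le v_le
  have "\<forall>\<^sub>F z in F. norm (u z * v z) \<le> exp (- (\<eta> / 2) * norm z powr s)"
  proof eventually_elim
    case (elim z)
    have "norm (u z * v z) \<le> exp (- \<eta> * norm z powr s) * exp (K * norm z powr s')"
      using elim by (intro order_trans[OF norm_mult_ineq] mult_mono) auto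
    also have "\<dots> \<le> exp (- (\<eta> / 2) * norm z powr s)"
      using elim(1) unfolding exp_add[symmetric] exp_le_cancel_iff by simp
    finally show ?case .
  qed
  then show ?thesis unfolding exp_small_def using rate_pos half_gt_zero by blast
qed

lemma exp_small_add:
  fixes u v :: "'a \<Rightarrow> 'b::real_normed_vector"
  assumes "exp_small s F u" "exp_small s F v" "s > 0"
  shows "exp_small s F (\<lambda>z. u z + v z)"
proof -
  obtain \<eta> \<zeta> where rates_pos: "\<eta> > 0" "\<zeta> > 0"
    and u_le: "\<forall>\<^sub>F z in F. norm (u z) \<le> exp (- \<eta> * norm z powr s)"
    and v_le: "\<forall>\<^sub>F z in F. norm (v z) \<le> exp (- \<zeta> * norm z powr s)"
    using assms unfolding exp_small_def by blast
  define \<mu> where "\<mu> = min \<eta> \<zeta>"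
  have "\<mu> > 0" using rates_pos by (simp add: \<mu>_def)
  then have "\<forall>\<^sub>F t in at_top. 2 \<le> exp (\<mu> / 2 * t powr s)"
    using \<open>s > 0\<close> by real_asymp
  from eventually_norm_at_infinity[OF F_le this] u_le v_le
  have "\<forall>\<^sub>F z in F. norm (u z + v z) \<le> exp (- (\<mu> / 2) * norm z powr s)"
  proof eventually_elim
    case (elim z)
    have "exp (- \<eta> * norm z powr s) \<le> exp (- \<mu> * norm z powr s)"
      "exp (- \<zeta> * norm z powr s) \<le> exp (- \<mu> * norm z powr s)"
      by (simp_all add: \<mu>_def mult_right_mono)
    then have "norm (u z + v z) \<le> 2 * exp (- \<mu> * norm z powr s)"
      using elim norm_triangle_ineq[of "u z" "v z"] by linarith
    also have "\<dots> \<le> exp (\<mu> / 2 * norm z powr s) * exp (- \<mu> * norm z powr s)"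
      using elim by (intro mult_right_mono) auto
    also have "\<dots> = exp (- (\<mu> / 2) * norm z powr s)" by (simp add: exp_add[symmetric])
    finally show ?case .
  qed
  with \<open>\<mu> > 0\<close> show ?thesis unfolding exp_small_def using half_gt_zero by blast
qed

lemma exp_small_imp_exp_bounded:
  assumes "exp_small s F u" "s' > 0"
  shows "exp_bounded s' F u"
proof (rule exp_bounded_of_bounded[OF _ assms(2)])
  obtain \<eta> where rate_pos: "\<eta> > 0" and u_le: "\<forall>\<^sub>F z in F. norm (u z) \<le> exp (- \<eta> * norm z powr s)"
    using assms(1) unfolding exp_small_def by blast
  from u_le show "\<forall>\<^sub>F z in F. norm (u z) \<le> 1"
  proof eventually_elim
    case (elim z)
    also have "exp (- \<eta> * norm z powr s) \<le> 1" using rate_pos by simp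
    finally show ?case .
  qed
qed

lemma exp_small_imp_eventually_le_inverse_power:
  assumes "exp_small s F u" "s > 0"
  shows "\<forall>\<^sub>F z in F. norm (u z) \<le> 1 / norm z ^ m"
proof -
  obtain \<eta> where rate_pos: "\<eta> > 0" and u_le: "\<forall>\<^sub>F z in F. norm (u z) \<le> exp (- \<eta> * norm z powr s)"
    using assms(1) unfolding exp_small_def by blast
  have "\<forall>\<^sub>F t in at_top. exp (- \<eta> * t powr s) \<le> 1 / t ^ m"
    using rate_pos \<open>s > 0\<close> by real_asymp
  from eventually_norm_at_infinity[OF F_le this] u_le show ?thesis
    by eventually_elim simp
qed

lemma not_exp_small_one:
  assumes "F \<noteq> bot" "s > 0"
  shows "\<not> exp_small s F (\<lambda>z. 1 :: 'b::real_normed_div_algebra)"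
proof
  assume "exp_small s F (\<lambda>z. 1 :: 'b)"
  from exp_small_imp_eventually_le_inverse_power[OF this \<open>s > 0\<close>, of 1]
    eventually_norm_at_infinity[OF F_le eventually_gt_at_top[of 1]]
  have "\<forall>\<^sub>F z in F. False" by eventually_elim (auto simp: le_divide_eq_1)
  then show False using assms(1) by simp
qed

end

section \<open>Estimates in a disc with the zeros divided out\<close>

lemma norm_less_norm_reflection:
  fixes v :: complex
  assumes "Re v < A" "0 < A"
  shows "norm v < norm (2 * of_real A - v)"
proof (rule power_less_imp_less_base)
  show "(norm v)\<^sup>2 < (norm (2 * of_real A - v))\<^sup>2"
    using mult_strict_left_mono[OF assms(1), of "4 * A"] assms(2)
    unfolding cmod_power2 by (simp add: power2_eq_square algebra_simps)
qed simp

theorem Borel_Caratheodory: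
  fixes u :: "complex \<Rightarrow> complex"
  assumes hol: "u holomorphic_on ball z0 \<rho>" and zero_at_center: "u z0 = 0"
    and Re_less: "\<And>z. z \<in> ball z0 \<rho> \<Longrightarrow> Re (u z) < A"
    and z_dist: "norm (z - z0) \<le> r" "r < \<rho>"
  shows "norm (u z) \<le> 2 * r / (\<rho> - r) * A"
proof -
  have rho_pos: "\<rho> > 0" and r_nonneg: "r \<ge> 0" using z_dist norm_ge_zero[of "z - z0"] by linarith+
  have A_pos: "A > 0" using Re_less[of z0] zero_at_center rho_pos by simp
  define v where "v \<zeta> = u (z0 + of_real \<rho> * \<zeta>)" for \<zeta>
  define w where "w \<zeta> = v \<zeta> / (2 * of_real A - v \<zeta>)" for \<zeta>
  have in_ball: "z0 + of_real \<rho> * \<zeta> \<in> ball z0 \<rho>" if "norm \<zeta> < 1" for \<zeta>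
    using that rho_pos by (simp add: dist_norm norm_mult)
  have less: "norm (v \<zeta>) < norm (2 * of_real A - v \<zeta>)" if "norm \<zeta> < 1" for \<zeta>
    using Re_less[OF in_ball[OF that]] A_pos by (simp add: v_def norm_less_norm_reflection)
  have nonzero: "2 * of_real A - v \<zeta> \<noteq> 0" if "norm \<zeta> < 1" for \<zeta>
    using less[OF that] by auto
  have "(u \<circ> (\<lambda>\<zeta>. z0 + of_real \<rho> * \<zeta>)) holomorphic_on ball 0 1"
    by (rule holomorphic_on_compose_gen[OF _ hol])
      (use in_ball in \<open>auto intro!: holomorphic_intros\<close>)
  then have "v holomorphic_on ball 0 1" by (simp add: v_def[abs_def] o_def)
  then have w_hol: "w holomorphic_on ball 0 1"
    unfolding w_def using nonzero by (intro holomorphic_intros) auto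
  define \<zeta> where "\<zeta> = (z - z0) / of_real \<rho>"
  have zeta_bounds: "norm \<zeta> \<le> r / \<rho>" "r / \<rho> < 1" "norm \<zeta> < 1"
    using z_dist rho_pos by (auto simp: \<zeta>_def norm_divide divide_le_cancel)
  have "norm (w \<zeta>) \<le> norm \<zeta>"
  proof (rule Schwarz_Lemma(1)[OF w_hol])
    show "w 0 = 0" by (simp add: w_def v_def zero_at_center)
    show "norm (w x) < 1" if "norm x < 1" for x
      using less[OF that] nonzero[OF that] by (simp add: w_def norm_divide divide_less_eq_1)
  qed (rule zeta_bounds(3))
  with zeta_bounds(1) have w_le: "norm (w \<zeta>) \<le> r / \<rho>" by simp
  have "v \<zeta> = w \<zeta> * (2 * of_real A - v \<zeta>)"
    using nonzero[OF zeta_bounds(3)] by (simp add: w_def)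
  then have "norm (v \<zeta>) = norm (w \<zeta>) * norm (2 * of_real A - v \<zeta>)"
    by (metis norm_mult)
  also have "\<dots> \<le> r / \<rho> * (2 * A + norm (v \<zeta>))"
    using w_le A_pos norm_triangle_ineq4[of "2 * of_real A" "v \<zeta>"] r_nonneg rho_pos
    by (intro mult_mono) auto
  finally have "norm (v \<zeta>) \<le> 2 * r / (\<rho> - r) * A"
    using rho_pos z_dist(2) by (simp add: field_simps)
  then show ?thesis using rho_pos by (simp add: v_def \<zeta>_def)
qed

lemma holomorphic_on_prod_list_linear [holomorphic_intros]:
  "(\<lambda>z. \<Prod>a\<leftarrow>as. z - a) holomorphic_on S"
  by (induction as) (auto intro!: holomorphic_intros)

lemma norm_prod_list_diff_mono:
  fixes x y :: "'a::real_normed_field"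
  assumes "\<And>a. a \<in> set as \<Longrightarrow> k * norm (x - a) \<le> norm (y - a)" "k \<ge> 0"
  shows "k ^ length as * norm (\<Prod>a\<leftarrow>as. x - a) \<le> norm (\<Prod>a\<leftarrow>as. y - a)"
  using assms(1)
proof (induction as)
  case (Cons a as)
  have "k ^ length (a # as) * norm (\<Prod>b\<leftarrow>a # as. x - b)
      = (k * norm (x - a)) * (k ^ length as * norm (\<Prod>b\<leftarrow>as. x - b))"
    by (simp add: norm_mult)
  also have "\<dots> \<le> norm (y - a) * norm (\<Prod>b\<leftarrow>as. y - b)"
    using Cons \<open>k \<ge> 0\<close> by (intro mult_mono) auto
  finally show ?case by (simp add: norm_mult)
qed simp

lemma norm_deriv_prod_list_diff_le:
  fixes z :: complex
  assumes "\<And>a. a \<in> set as \<Longrightarrow> d \<le> norm (z - a)" "d > 0"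
  shows "norm (deriv (\<lambda>z. \<Prod>a\<leftarrow>as. z - a) z) \<le> real (length as) / d * norm (\<Prod>a\<leftarrow>as. z - a)"
  using assms(1)
proof (induction as)
  case (Cons b as)
  define p where "p = (\<lambda>z::complex. \<Prod>a\<leftarrow>as. z - a)"
  have "(p has_field_derivative deriv p z) (at z)"
    unfolding p_def
    by (rule holomorphic_derivI[OF holomorphic_on_prod_list_linear open_UNIV UNIV_I])
  then have "((\<lambda>z. (z - b) * p z) has_field_derivative p z + (z - b) * deriv p z) (at z)"
    by (auto intro!: derivative_eq_intros)
  then have "deriv (\<lambda>z. \<Prod>a\<leftarrow>b # as. z - a) z = p z + (z - b) * deriv p z"
    by (simp add: p_def DERIV_imp_deriv)
  then have "norm (deriv (\<lambda>z. \<Prod>a\<leftarrow>b # as. z - a) z) \<le> norm (p z) + norm (z - b) * norm (deriv p z)"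
    by (metis norm_mult norm_triangle_ineq)
  also have "\<dots> \<le> norm (z - b) / d * norm (p z) + norm (z - b) * (real (length as) / d * norm (p z))"
  proof (intro add_mono mult_left_mono)
    show "norm (p z) \<le> norm (z - b) / d * norm (p z)"
      using Cons.prems[of b] \<open>d > 0\<close> mult_right_mono[of 1 "norm (z - b) / d" "norm (p z)"] by simp
    show "norm (deriv p z) \<le> real (length as) / d * norm (p z)"
      using Cons by (simp add: p_def)
  qed simp
  also have "\<dots> = real (length (b # as)) / d * (norm (z - b) * norm (p z))"
    using \<open>d > 0\<close> by (simp add: field_simps)
  finally show ?case by (simp add: p_def norm_mult)
qed simp

lemma entire_factor_zero:
  assumes "g holomorphic_on UNIV" "g a = 0"
  obtains h where "h holomorphic_on UNIV" "\<And>z. g z = (z - a) * h z"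
proof
  show "(\<lambda>z. if z = a then deriv g a else (g z - g a) / (z - a)) holomorphic_on UNIV"
    by (rule pole_lemma_open) (use assms in auto)
qed (use assms in auto)

locale entire_bounded_on_sphere =
  fixes F :: "complex \<Rightarrow> complex" and z0 :: complex and R L :: real
  assumes holomorphic: "F holomorphic_on UNIV"
    and radius_pos: "R > 0"
    and nonzero_center: "F z0 \<noteq> 0"
    and norm_le_on_sphere: "\<And>z. z \<in> sphere z0 R \<Longrightarrow> norm (F z) \<le> exp L * norm (F z0)"
begin

definition factorization :: "complex list \<Rightarrow> (complex \<Rightarrow> complex) \<Rightarrow> bool" where
  "factorization as g \<longleftrightarrow> g holomorphic_on UNIV \<and> (\<forall>z. F z = (\<Prod>a\<leftarrow>as. z - a) * g z) \<and>
     set as \<subseteq> cball z0 (R / 4)"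

context
  fixes as g
  assumes fac: "factorization as g"
begin

lemma factorization_eq: "F z = (\<Prod>a\<leftarrow>as. z - a) * g z"
  using fac by (simp add: factorization_def)

lemma factorization_holomorphic: "g holomorphic_on UNIV"
  using fac by (simp add: factorization_def)

lemma factorization_nonzero_center: "g z0 \<noteq> 0"
  using nonzero_center by (auto simp: factorization_eq)

lemma factorization_zero: "a \<in> set as \<Longrightarrow> F a = 0"
  by (simp add: factorization_eq prod_list_zero_iff)

lemma factorization_dist_center: "a \<in> set as \<Longrightarrow> norm (z0 - a) \<le> R / 4"
  using fac by (auto simp: factorization_def dist_norm)

lemma factorization_norm_le_on_sphere:
  assumes on_sphere: "z \<in> sphere z0 R"
  shows "3 ^ length as * norm (g z) \<le> exp L * norm (g z0)"
proof -
  let ?p = "\<lambda>z. \<Prod>a\<leftarrow>as. z - a"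
  have prod_le: "3 ^ length as * norm (?p z0) \<le> norm (?p z)"
  proof (rule norm_prod_list_diff_mono)
    fix a assume "a \<in> set as"
    then show "3 * norm (z0 - a) \<le> norm (z - a)"
      using factorization_dist_center[of a] on_sphere norm_triangle_ineq4[of "z - a" "z0 - a"]
      by (simp add: dist_norm norm_minus_commute)
  qed simp
  have "norm (?p z0) * (3 ^ length as * norm (g z)) \<le> norm (F z)"
    using mult_right_mono[OF prod_le, of "norm (g z)"]
    by (simp add: factorization_eq norm_mult mult_ac)
  also have "\<dots> \<le> norm (?p z0) * (exp L * norm (g z0))"
    using norm_le_on_sphere[OF on_sphere] by (simp add: factorization_eq norm_mult mult_ac)
  finally show ?thesis
    using nonzero_center by (auto simp: factorization_eq)
qed

lemma factorization_norm_le: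
  assumes in_disc: "z \<in> cball z0 R"
  shows "3 ^ length as * norm (g z) \<le> exp L * norm (g z0)"
proof -
  have "norm (g z) \<le> exp L * norm (g z0) / 3 ^ length as"
  proof (rule maximum_modulus_frontier[of g "cball z0 R"])
    show "g holomorphic_on interior (cball z0 R)" "continuous_on (closure (cball z0 R)) g"
      using factorization_holomorphic
      by (auto intro: holomorphic_on_subset continuous_on_subset holomorphic_on_imp_continuous_on)
    show "norm (g w) \<le> exp L * norm (g z0) / 3 ^ length as" if "w \<in> frontier (cball z0 R)" for w
      using factorization_norm_le_on_sphere[of w] that radius_pos by (simp add: field_simps)
  qed (use in_disc in auto)
  then show ?thesis by (simp add: field_simps)
qed

lemma factorization_length_le: "real (length as) \<le> L"
proof -
  have "3 ^ length as * norm (g z0) \<le> exp L * norm (g z0)"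
    using radius_pos by (intro factorization_norm_le) simp
  then have "3 ^ length as \<le> exp L" using factorization_nonzero_center by simp
  moreover have "exp (real (length as)) \<le> 3 ^ length as"
    using exp_le by (simp add: exp_of_nat_mult[of "length as" 1, simplified] power_mono)
  ultimately have "exp (real (length as)) \<le> exp L" by linarith
  then show ?thesis by simp
qed

end

text \<open>The number of factors in any factorisation is bounded, so one with the most factors exists.\<close>

lemma ex_zero_free_factorization:
  obtains as g where "factorization as g" "\<And>z. z \<in> cball z0 (R / 4) \<Longrightarrow> g z \<noteq> 0"
proof -
  let ?has_length = "\<lambda>N. \<exists>as g. factorization as g \<and> length as = N"
  have "?has_length 0"
    using holomorphic by (intro exI[of _ "[]"] exI[of _ F]) (simp add: factorization_def)
  moreover have "N \<le> nat \<lfloor>L\<rfloor>" if "?has_length N" for N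
    using that factorization_length_le by (auto simp: le_nat_floor)
  ultimately obtain N where maximal: "?has_length N" "\<And>N'. ?has_length N' \<Longrightarrow> N' \<le> N"
    using Nat.ex_has_greatest_nat[of ?has_length 0 "nat \<lfloor>L\<rfloor>"] by blast
  then obtain as g where fac: "factorization as g" and length_eq: "length as = N" by blast
  have "g z \<noteq> 0" if in_disc: "z \<in> cball z0 (R / 4)" for z
  proof
    assume "g z = 0"
    then obtain h where "h holomorphic_on UNIV" "\<And>w. g w = (w - z) * h w"
      using entire_factor_zero factorization_holomorphic[OF fac] by blast
    then have "factorization (z # as) h"
      using fac in_disc by (simp add: factorization_def mult_ac)
    then show False using maximal(2)[of "Suc N"] length_eq by force
  qed
  with fac show ?thesis by (rule that)
qed

context
  fixes as g
  assumes fac: "factorization as g" and zero_free: "\<And>z. z \<in> cball z0 (R / 4) \<Longrightarrow> g z \<noteq> 0"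
begin

lemma zero_free_factorization_ex_log:
  obtains u where "u holomorphic_on ball z0 (R / 4)"
    "\<And>z. z \<in> ball z0 (R / 4) \<Longrightarrow> g z = g z0 * exp (u z)"
    "\<And>z. z \<in> cball z0 (R / 8) \<Longrightarrow> norm (u z) \<le> 2 * (L + 1)"
proof -
  have hol: "g holomorphic_on ball z0 (R / 4)"
    using factorization_holomorphic[OF fac] by (rule holomorphic_on_subset) simp
  obtain l where log_g: "l holomorphic_on ball z0 (R / 4)"
    "\<And>z. z \<in> ball z0 (R / 4) \<Longrightarrow> exp (l z) = g z"
    by (rule holomorphic_logarithm_exists[OF _ _ hol, of z0])
       (use zero_free radius_pos in auto)
  define u where "u z = l z - l z0" for z
  have g_eq: "g z = g z0 * exp (u z)" if "z \<in> ball z0 (R / 4)" for z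
    using log_g(2)[OF that] log_g(2)[of z0] radius_pos factorization_nonzero_center[OF fac]
    by (simp add: u_def exp_diff)
  have u_hol: "u holomorphic_on ball z0 (R / 4)" unfolding u_def by (intro holomorphic_intros log_g)
  have "Re (u z) < L + 1" if in_ball: "z \<in> ball z0 (R / 4)" for z
  proof -
    have "norm (g z) \<le> 3 ^ length as * norm (g z)" by (simp add: mult_le_cancel_right1)
    also have "\<dots> \<le> exp L * norm (g z0)"
      by (rule factorization_norm_le[OF fac]) (use in_ball radius_pos in auto)
    finally have "exp (Re (u z)) \<le> exp L"
      using g_eq[OF in_ball] factorization_nonzero_center[OF fac] by (simp add: norm_mult)
    then show ?thesis by simp
  qed
  then have "norm (u z) \<le> 2 * (R / 8) / (R / 4 - R / 8) * (L + 1)" if "z \<in> cball z0 (R / 8)" for z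
    using that radius_pos
    by (intro Borel_Caratheodory[OF u_hol]) (auto simp: u_def dist_norm norm_minus_commute)
  then show ?thesis using that[OF u_hol g_eq] radius_pos by simp
qed

lemma zero_free_factorization_norm_ge:
  assumes in_disc: "z \<in> cball z0 (R / 16)"
  shows "exp (- (2 * (L + 1))) * norm (g z0) \<le> norm (g z)"
proof -
  obtain u where log_g: "u holomorphic_on ball z0 (R / 4)"
    "\<And>z. z \<in> ball z0 (R / 4) \<Longrightarrow> g z = g z0 * exp (u z)"
    "\<And>z. z \<in> cball z0 (R / 8) \<Longrightarrow> norm (u z) \<le> 2 * (L + 1)"
    by (rule zero_free_factorization_ex_log) (rule that)
  have "- (2 * (L + 1)) \<le> Re (u z)"
    using log_g(3)[of z] abs_Re_le_cmod[of "u z"] in_disc radius_pos by simp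
  then have "exp (- (2 * (L + 1))) * norm (g z0) \<le> exp (Re (u z)) * norm (g z0)"
    by (simp add: mult_right_mono)
  also have "\<dots> = norm (g z)" using log_g(2)[of z] in_disc radius_pos by (simp add: norm_mult)
  finally show ?thesis .
qed

lemma zero_free_factorization_norm_deriv_le:
  assumes in_disc: "z \<in> cball z0 (R / 16)"
  shows "norm (deriv g z) \<le> 32 * (L + 1) / R * norm (g z)"
proof -
  obtain u where log_g: "u holomorphic_on ball z0 (R / 4)"
    "\<And>z. z \<in> ball z0 (R / 4) \<Longrightarrow> g z = g z0 * exp (u z)"
    "\<And>z. z \<in> cball z0 (R / 8) \<Longrightarrow> norm (u z) \<le> 2 * (L + 1)"
    by (rule zero_free_factorization_ex_log) (rule that)
  have in_ball: "z \<in> ball z0 (R / 4)" using in_disc radius_pos by simp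
  have subsets: "cball z (R / 16) \<subseteq> cball z0 (R / 8)" "cball z (R / 16) \<subseteq> ball z0 (R / 4)"
    using in_disc radius_pos
    by (auto simp: cball_subset_cball_iff cball_subset_ball_iff dist_commute)
  have "norm ((deriv ^^ 1) u z) \<le> fact 1 * (2 * (L + 1)) / (R / 16) ^ 1"
  proof (rule Cauchy_inequality)
    show "u holomorphic_on ball z (R / 16)" "continuous_on (cball z (R / 16)) u"
      using log_g(1) subsets(2) ball_subset_cball[of z "R / 16"]
      by (meson holomorphic_on_subset holomorphic_on_imp_continuous_on order_trans)+
    show "norm (u x) \<le> 2 * (L + 1)" if "norm (z - x) = R / 16" for x
      using that subsets(1) by (intro log_g(3)) (auto simp: dist_norm)
  qed (use radius_pos in auto)
  then have deriv_u: "norm (deriv u z) \<le> 32 * (L + 1) / R" by simp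
  have "(u has_field_derivative deriv u z) (at z)"
    using log_g(1) in_ball by (simp add: holomorphic_derivI)
  then have "((\<lambda>z. g z0 * exp (u z)) has_field_derivative g z0 * (exp (u z) * deriv u z)) (at z)"
    by (auto intro!: derivative_eq_intros)
  then have "(g has_field_derivative g z0 * (exp (u z) * deriv u z)) (at z)"
    by (rule has_field_derivative_transform_within_open[OF _ open_ball in_ball])
      (simp add: log_g(2))
  then have "deriv g z = g z * deriv u z"
    using log_g(2)[OF in_ball] by (simp add: DERIV_imp_deriv)
  then show ?thesis
    using mult_right_mono[OF deriv_u, of "norm (g z)"] by (simp add: norm_mult mult_ac)
qed

lemma zero_free_factorization_zeros: "{a \<in> cball z0 (R / 4). F a = 0} = set as"
proof -
  have "a \<in> set as" if "a \<in> cball z0 (R / 4)" "F a = 0" for a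
    using that zero_free by (auto simp: factorization_eq[OF fac] prod_list_zero_iff)
  then show ?thesis
    using factorization_zero[OF fac] fac by (auto simp: factorization_def)
qed

end

lemma card_zeros_le:
  shows "finite {a \<in> cball z0 (R / 4). F a = 0}"
    and "real (card {a \<in> cball z0 (R / 4). F a = 0}) \<le> L"
proof -
  obtain as g where fac: "factorization as g" and zero_free: "\<And>z. z \<in> cball z0 (R / 4) \<Longrightarrow> g z \<noteq> 0"
    using ex_zero_free_factorization by blast
  show "finite {a \<in> cball z0 (R / 4). F a = 0}"
    using zero_free_factorization_zeros[OF fac zero_free] by simp
  have "card (set as) \<le> length as" by (rule card_length)
  then show "real (card {a \<in> cball z0 (R / 4). F a = 0}) \<le> L"
    using zero_free_factorization_zeros[OF fac zero_free] factorization_length_le[OF fac] by simp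
qed

context
  fixes z :: complex and d :: real
  assumes in_disc: "z \<in> cball z0 (R / 16)" and d_pos: "d > 0"
    and away: "\<And>a. F a = 0 \<Longrightarrow> d \<le> norm (z - a)"
begin

lemma norm_deriv_le_away_from_zeros:
  "norm (deriv F z) \<le> (L / d + 32 * (L + 1) / R) * norm (F z)"
proof -
  obtain as g where fac: "factorization as g" and zero_free: "\<And>z. z \<in> cball z0 (R / 4) \<Longrightarrow> g z \<noteq> 0"
    using ex_zero_free_factorization by blast
  define p where "p = (\<lambda>z. \<Prod>a\<leftarrow>as. z - a)"
  have F_eq: "F = (\<lambda>z. p z * g z)" by (simp add: p_def fun_eq_iff factorization_eq[OF fac])
  have "deriv F z = deriv p z * g z + p z * deriv g z"
    unfolding F_eq p_def
    using holomorphic_on_imp_differentiable_at[OF factorization_holomorphic[OF fac]]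
      holomorphic_on_imp_differentiable_at[OF holomorphic_on_prod_list_linear, of UNIV]
    by (subst deriv_mult) auto
  then have "norm (deriv F z) \<le> norm (deriv p z) * norm (g z) + norm (p z) * norm (deriv g z)"
    by (metis norm_mult norm_triangle_ineq)
  also have "\<dots> \<le> (L / d * norm (p z)) * norm (g z) + norm (p z) * (32 * (L + 1) / R * norm (g z))"
  proof (intro add_mono mult_left_mono mult_right_mono)
    have "norm (deriv p z) \<le> real (length as) / d * norm (p z)"
      unfolding p_def
      by (rule norm_deriv_prod_list_diff_le) (use away factorization_zero[OF fac] d_pos in auto)
    also have "\<dots> \<le> L / d * norm (p z)"
      using factorization_length_le[OF fac] d_pos by (intro mult_right_mono divide_right_mono) auto
    finally show "norm (deriv p z) \<le> L / d * norm (p z)" .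
    show "norm (deriv g z) \<le> 32 * (L + 1) / R * norm (g z)"
      by (rule zero_free_factorization_norm_deriv_le[OF fac zero_free in_disc])
  qed simp_all
  also have "\<dots> = (L / d + 32 * (L + 1) / R) * norm (F z)"
    by (simp add: F_eq norm_mult algebra_simps)
  finally show ?thesis .
qed

lemma norm_ge_away_from_zeros:
  assumes "d \<le> R / 4"
  shows "exp (- (L * ln (R / (4 * d)) + 2 * (L + 1))) * norm (F z0) \<le> norm (F z)"
proof -
  obtain as g where fac: "factorization as g" and zero_free: "\<And>z. z \<in> cball z0 (R / 4) \<Longrightarrow> g z \<noteq> 0"
    using ex_zero_free_factorization by blast
  let ?p = "\<lambda>z. \<Prod>a\<leftarrow>as. z - a" and ?k = "4 * d / R"
  have "real (length as) * ln (R / (4 * d)) \<le> L * ln (R / (4 * d))"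
    using factorization_length_le[OF fac] d_pos assms by (intro mult_right_mono) auto
  then have "exp (- (L * ln (R / (4 * d)))) \<le> exp (- (real (length as) * ln (R / (4 * d))))" by simp
  also have "\<dots> = ?k ^ length as"
    using d_pos radius_pos by (simp add: exp_minus exp_of_nat_mult power_divide)
  finally have "exp (- (L * ln (R / (4 * d)))) * norm (?p z0) \<le> ?k ^ length as * norm (?p z0)"
    by (intro mult_right_mono) auto
  also have "\<dots> \<le> norm (?p z)"
  proof (rule norm_prod_list_diff_mono)
    fix a assume root: "a \<in> set as"
    have "?k * norm (z0 - a) \<le> ?k * (R / 4)"
      using factorization_dist_center[OF fac root] d_pos radius_pos by (intro mult_left_mono) auto
    also have "\<dots> = d" using radius_pos by simp
    also have "\<dots> \<le> norm (z - a)" by (rule away[OF factorization_zero[OF fac root]])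
    finally show "?k * norm (z0 - a) \<le> norm (z - a)" .
  qed (use d_pos radius_pos in simp)
  finally have prod_le: "exp (- (L * ln (R / (4 * d)))) * norm (?p z0) \<le> norm (?p z)" .
  have "exp (- (L * ln (R / (4 * d)) + 2 * (L + 1))) * norm (F z0)
      = (exp (- (L * ln (R / (4 * d)))) * norm (?p z0)) * (exp (- (2 * (L + 1))) * norm (g z0))"
    unfolding factorization_eq[OF fac, of z0] norm_mult minus_add_distrib exp_add by simp
  also have "\<dots> \<le> norm (?p z) * norm (g z)"
    using prod_le zero_free_factorization_norm_ge[OF fac zero_free in_disc] by (rule mult_mono) auto
  finally show ?thesis by (simp add: factorization_eq[OF fac, of z] norm_mult)
qed

end

end

section \<open>Rays avoiding a sparse set\<close>

definition poly_sparse :: "complex set \<Rightarrow> bool" where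
  "poly_sparse Z \<longleftrightarrow> (\<exists>N. \<forall>\<^sub>F r in at_top.
     finite (Z \<inter> cball 0 r) \<and> real (card (Z \<inter> cball 0 r)) \<le> r ^ N)"

definition poly_separated :: "complex filter \<Rightarrow> complex set \<Rightarrow> bool" where
  "poly_separated F Z \<longleftrightarrow> (\<exists>N. \<forall>\<^sub>F z in F. \<forall>a\<in>Z. 1 / norm z ^ N \<le> dist z a)"

definition slope :: "complex \<Rightarrow> real" where
  "slope z = Im z / Re z"

lemma poly_sparse_finite:
  assumes "poly_sparse Z"
  shows "finite (Z \<inter> cball 0 r)"
proof -
  have "\<forall>\<^sub>F r' in at_top. finite (Z \<inter> cball 0 r')"
    using assms unfolding poly_sparse_def by (auto elim: eventually_mono)
  with eventually_ge_at_top[of r] have "\<forall>\<^sub>F r' in at_top. r \<le> r' \<and> finite (Z \<inter> cball 0 r')"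
    by (rule eventually_conj)
  then obtain r' where "r \<le> r'" "finite (Z \<inter> cball 0 r')"
    using eventually_happens by force
  moreover have "Z \<inter> cball 0 r \<subseteq> Z \<inter> cball 0 r'" using \<open>r \<le> r'\<close> by auto
  ultimately show ?thesis using finite_subset by blast
qed

lemma poly_sparse_card_le:
  assumes "poly_sparse Z"
  obtains N where "\<forall>\<^sub>F r in at_top. real (card (Z \<inter> cball 0 r)) \<le> r ^ N"
proof -
  obtain N where "\<forall>\<^sub>F r in at_top. finite (Z \<inter> cball 0 r) \<and> real (card (Z \<inter> cball 0 r)) \<le> r ^ N"
    using assms unfolding poly_sparse_def by blast
  then have "\<forall>\<^sub>F r in at_top. real (card (Z \<inter> cball 0 r)) \<le> r ^ N" by (rule eventually_mono) blast
  then show ?thesis by (rule that)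
qed

lemma poly_sparse_Un:
  assumes A_sparse: "poly_sparse A" and B_sparse: "poly_sparse B"
  shows "poly_sparse (A \<union> B)"
proof -
  obtain M where A_count: "\<forall>\<^sub>F r in at_top. real (card (A \<inter> cball 0 r)) \<le> r ^ M"
    using poly_sparse_card_le[OF A_sparse] .
  obtain N where B_count: "\<forall>\<^sub>F r in at_top. real (card (B \<inter> cball 0 r)) \<le> r ^ N"
    using poly_sparse_card_le[OF B_sparse] .
  have "\<forall>\<^sub>F r::real in at_top. r ^ M + r ^ N \<le> r ^ (M + N + 1)"
    using eventually_ge_at_top[of 2]
  proof eventually_elim
    case (elim r)
    have "r ^ M \<le> r ^ (M + N)" "r ^ N \<le> r ^ (M + N)"
      using elim by (intro power_increasing; simp)+
    then have "r ^ M + r ^ N \<le> 2 * r ^ (M + N)" by simp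
    also have "\<dots> \<le> r * r ^ (M + N)" using elim by (intro mult_right_mono) auto
    finally show ?case by simp
  qed
  with A_count B_count have "\<forall>\<^sub>F r in at_top. real (card ((A \<union> B) \<inter> cball 0 r)) \<le> r ^ (M + N + 1)"
  proof eventually_elim
    case (elim r)
    have "card ((A \<union> B) \<inter> cball 0 r) \<le> card (A \<inter> cball 0 r) + card (B \<inter> cball 0 r)"
      unfolding Int_Un_distrib2 by (rule card_Un_le)
    then show ?case using elim by linarith
  qed
  moreover have "finite ((A \<union> B) \<inter> cball 0 r)" for r
    using poly_sparse_finite[OF A_sparse] poly_sparse_finite[OF B_sparse]
    by (simp add: Int_Un_distrib2)
  ultimately show ?thesis unfolding poly_sparse_def by (intro exI[of _ "M + N + 1"]) simp
qed

lemma poly_separated_mono: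
  assumes "poly_separated F Z" "Y \<subseteq> Z"
  shows "poly_separated F Y"
proof -
  obtain N where "\<forall>\<^sub>F z in F. \<forall>a\<in>Z. 1 / norm z ^ N \<le> dist z a"
    using assms(1) unfolding poly_separated_def by blast
  then have "\<forall>\<^sub>F z in F. \<forall>a\<in>Y. 1 / norm z ^ N \<le> dist z a"
    by (rule eventually_mono) (use assms(2) in blast)
  then show ?thesis unfolding poly_separated_def by blast
qed

lemma AE_eventually_far_from_finite_sets:
  fixes S :: "nat \<Rightarrow> real set" and \<epsilon> :: "nat \<Rightarrow> real"
  assumes finite: "\<And>m. finite (S m)" and eps_nonneg: "\<And>m. \<epsilon> m \<ge> 0"
    and summable: "summable (\<lambda>m. real (card (S m)) * \<epsilon> m)"
  shows "AE x in lborel. \<forall>\<^sub>F m in sequentially. \<forall>p\<in>S m. \<epsilon> m < \<bar>x - p\<bar>"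
proof -
  define A where "A m = (\<Union>p\<in>S m. {p - \<epsilon> m..p + \<epsilon> m})" for m
  have "AE x in lborel. \<forall>\<^sub>F m in sequentially. x \<in> space lborel - A m"
  proof (rule borel_cantelli_AE1)
    show "A m \<in> sets lborel" for m
      using finite by (auto simp: A_def)
    show "emeasure lborel (A m) < \<infinity>" for m
    proof (rule emeasure_bounded_finite)
      show "bounded (A m)" unfolding A_def using finite by (intro bounded_UN) auto
    qed
    show "summable (\<lambda>m. measure lborel (A m))"
    proof (rule summable_comparison_test')
      show "summable (\<lambda>m. 2 * (real (card (S m)) * \<epsilon> m))" using summable by (rule summable_mult)
      show "norm (measure lborel (A m)) \<le> 2 * (real (card (S m)) * \<epsilon> m)" for m
        using measure_UNION_le[OF finite[of m], of "\<lambda>p. {p - \<epsilon> m..p + \<epsilon> m}" lborel] eps_nonneg[of m]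
        by (simp add: A_def)
    qed
  qed
  then show ?thesis
  proof (rule AE_mp, intro AE_I2 impI)
    fix x assume "\<forall>\<^sub>F m in sequentially. x \<in> space lborel - A m"
    then show "\<forall>\<^sub>F m in sequentially. \<forall>p\<in>S m. \<epsilon> m < \<bar>x - p\<bar>"
      by eventually_elim (force simp: A_def abs_le_iff not_less[symmetric])
  qed
qed

lemma ex_in_open_of_AE_lborel:
  fixes S :: "'a::euclidean_space set"
  assumes "AE x in lborel. P x" "open S" "S \<noteq> {}"
  shows "\<exists>x\<in>S. P x"
proof (rule ccontr)
  assume "\<not> (\<exists>x\<in>S. P x)"
  then have "AE x in lborel. x \<notin> S"
    using assms(1) by (auto elim!: eventually_mono)
  then have "S \<in> null_sets lborel"
    using assms(2) by (simp add: AE_iff_null_sets)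
  then have "negligible S"
    using null_sets_completionI negligible_iff_null_sets by blast
  then show False using assms(2,3) open_not_negligible by blast
qed

lemma slope_dist_le:
  assumes "norm (w - b) \<le> d" "\<bar>Im w\<bar> \<le> Re w" "1 + d \<le> Re w"
  shows "\<bar>slope w - slope b\<bar> \<le> 2 * d"
proof -
  have dist: "\<bar>Re w - Re b\<bar> \<le> d" "\<bar>Im w - Im b\<bar> \<le> d"
    using abs_Re_le_cmod[of "w - b"] abs_Im_le_cmod[of "w - b"] assms(1) by simp_all
  then have d_nonneg: "d \<ge> 0" and Re_b_ge: "Re b \<ge> 1" and Re_w_pos: "Re w > 0"
    using assms(3) by linarith+
  have "slope w - slope b = ((Im w - Im b) + slope w * (Re b - Re w)) / Re b"
    using Re_b_ge Re_w_pos by (simp add: slope_def field_simps)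
  also have "\<bar>\<dots>\<bar> \<le> (d + 1 * d) / 1"
    unfolding abs_divide
  proof (intro frac_le)
    have "\<bar>slope w\<bar> \<le> 1" using assms(2) Re_w_pos by (simp add: slope_def abs_divide)
    then have "\<bar>slope w * (Re b - Re w)\<bar> \<le> 1 * d"
      unfolding abs_mult using dist by (intro mult_mono) (auto simp: abs_minus_commute)
    then show "\<bar>Im w - Im b + slope w * (Re b - Re w)\<bar> \<le> d + 1 * d"
      using dist(2) by linarith
  qed (use Re_b_ge d_nonneg in auto)
  finally show ?thesis by simp
qed

lemma slope_close_of_rcis_close:
  assumes "0 \<le> \<alpha>" "\<alpha> \<le> pi / 4" "4 \<le> t" "dist (rcis t (x + \<alpha>)) a \<le> d" "d \<le> 1"
  shows "\<bar>tan \<alpha> - slope (a * cis (- x))\<bar> \<le> 2 * d"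
proof -
  have "rcis t \<alpha> - a * cis (- x) = (rcis t (x + \<alpha>) - a) * cis (- x)"
    by (simp add: rcis_def left_diff_distrib mult.assoc cis_mult)
  then have "norm (rcis t \<alpha> - a * cis (- x)) \<le> d"
    using assms(4) by (simp add: norm_mult dist_norm)
  moreover have "cos (pi / 3) \<le> cos \<alpha>" using assms by (intro cos_monotone_0_pi_le) auto
  then have "1 / 2 \<le> cos \<alpha>" by (simp add: cos_60)
  then have "4 * (1 / 2) \<le> t * cos \<alpha>" using assms(3) by (intro mult_mono) auto
  then have "1 + d \<le> Re (rcis t \<alpha>)" using assms(5) by simp
  moreover have "\<bar>Im (rcis t \<alpha>)\<bar> \<le> Re (rcis t \<alpha>)"
  proof -
    have "sin \<alpha> \<le> sin (pi / 4)" using assms by (intro sin_monotone_2pi_le) auto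
    also have "\<dots> = cos (pi / 4)" by (simp add: sin_45 cos_45)
    also have "\<dots> \<le> cos \<alpha>" using assms by (intro cos_monotone_0_pi_le) auto
    finally have "t * sin \<alpha> \<le> t * cos \<alpha>" using assms(3) by (intro mult_left_mono) auto
    moreover have "sin \<alpha> \<ge> 0" using assms by (intro sin_ge_zero) auto
    ultimately show ?thesis using assms(3) by (simp add: abs_mult)
  qed
  ultimately have "\<bar>slope (rcis t \<alpha>) - slope (a * cis (- x))\<bar> \<le> 2 * d"
    by (intro slope_dist_le)
  moreover have "slope (rcis t \<alpha>) = tan \<alpha>"
    using assms(3) by (simp add: slope_def tan_def)
  ultimately show ?thesis by simp
qed

lemma AE_slope_eventually_far:
  assumes "poly_sparse Z"
  obtains N where
    "AE s in lborel. \<forall>\<^sub>F m in sequentially. \<forall>a\<in>Z \<inter> cball 0 (real m + 2).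
       2 / real m ^ N < \<bar>s - slope (a * cis (- x))\<bar>"
proof -
  obtain N where count_le: "\<forall>\<^sub>F r in at_top. real (card (Z \<inter> cball 0 r)) \<le> r ^ N"
    using poly_sparse_card_le[OF assms] .
  define S where "S m = (\<lambda>a. slope (a * cis (- x))) ` (Z \<inter> cball 0 (real m + 2))" for m
  have card_le: "card (S m) \<le> card (Z \<inter> cball 0 (real m + 2))" for m
    unfolding S_def using poly_sparse_finite[OF assms] by (rule card_image_le)
  have "filterlim (\<lambda>m. real m + 2) at_top sequentially" by real_asymp
  with count_le
  have "\<forall>\<^sub>F m in sequentially. real (card (Z \<inter> cball 0 (real m + 2))) \<le> (real m + 2) ^ N"
    by (rule eventually_compose_filterlim)
  moreover have "\<forall>\<^sub>F m in sequentially.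
      (real m + 2) ^ N * (2 / real m ^ (N + 2)) \<le> 3 * (1 / real m ^ 2)"
    by real_asymp
  ultimately have "\<forall>\<^sub>F m in sequentially.
      norm (real (card (S m)) * (2 / real m ^ (N + 2))) \<le> 3 * (1 / real m ^ 2)"
  proof eventually_elim
    case (elim m)
    have "real (card (S m)) * (2 / real m ^ (N + 2)) \<le> (real m + 2) ^ N * (2 / real m ^ (N + 2))"
      using elim(1) card_le[of m] by (intro mult_right_mono) auto
    then show ?case using elim(2) by simp
  qed
  moreover have "summable (\<lambda>m. 3 * (1 / real m ^ 2))"
    using inverse_power_summable[of 2, where 'a = real]
    by (intro summable_mult) (simp add: field_simps)
  ultimately have "summable (\<lambda>m. real (card (S m)) * (2 / real m ^ (N + 2)))"
    by (rule summable_comparison_test_ev)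
  then have "AE s in lborel. \<forall>\<^sub>F m in sequentially. \<forall>p\<in>S m. 2 / real m ^ (N + 2) < \<bar>s - p\<bar>"
    using poly_sparse_finite[OF assms]
    by (intro AE_eventually_far_from_finite_sets) (auto simp: S_def)
  then show ?thesis by (intro that[of "N + 2"]) (simp add: S_def)
qed

lemma poly_separated_ray_of_slopes_far:
  assumes angle: "0 \<le> \<alpha>" "\<alpha> \<le> pi / 4"
    and far: "\<forall>\<^sub>F m in sequentially. \<forall>a\<in>Z \<inter> cball 0 (real m + 2).
      2 / real m ^ N < \<bar>tan \<alpha> - slope (a * cis (- x))\<bar>"
  shows "poly_separated (at_infinity_ray (x + \<alpha>)) Z"
proof -
  have "filterlim (\<lambda>t::real. nat \<lfloor>t\<rfloor>) sequentially at_top" by real_asymp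
  with far have "\<forall>\<^sub>F t::real in at_top. \<forall>a\<in>Z \<inter> cball 0 (real (nat \<lfloor>t\<rfloor>) + 2).
      2 / real (nat \<lfloor>t\<rfloor>) ^ N < \<bar>tan \<alpha> - slope (a * cis (- x))\<bar>"
    by (rule eventually_compose_filterlim)
  then have "\<forall>\<^sub>F t in at_top. \<forall>a\<in>Z. 1 / norm (rcis t (x + \<alpha>)) ^ N \<le> dist (rcis t (x + \<alpha>)) a"
    using eventually_ge_at_top[of 4]
  proof eventually_elim
    case (elim t)
    define m where "m = nat \<lfloor>t\<rfloor>"
    have m_bounds: "real m \<le> t" "t < real m + 1" "1 \<le> m" unfolding m_def using elim(2) by linarith+
    show ?case
    proof (rule ballI, rule ccontr)
      fix a assume "a \<in> Z" and "\<not> 1 / norm (rcis t (x + \<alpha>)) ^ N \<le> dist (rcis t (x + \<alpha>)) a"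
      then have close: "dist (rcis t (x + \<alpha>)) a < 1 / t ^ N" using elim(2) by simp
      also have le_1: "1 / t ^ N \<le> 1" using elim(2) one_le_power[of t N] by simp
      finally have "norm a \<le> real m + 2"
        using m_bounds(2) elim(2) norm_triangle_sub[of a "rcis t (x + \<alpha>)"]
        by (simp add: dist_norm norm_minus_commute)
      then have "2 / real m ^ N < \<bar>tan \<alpha> - slope (a * cis (- x))\<bar>"
        using elim(1) \<open>a \<in> Z\<close> by (simp add: m_def)
      also have "\<dots> \<le> 2 * (1 / t ^ N)"
        by (rule slope_close_of_rcis_close[OF angle elim(2) less_imp_le[OF close] le_1])
      also have "\<dots> \<le> 2 / real m ^ N"
        using m_bounds elim(2) by (simp add: frac_le power_mono)
      finally show False by simp
    qed
  qed
  then show ?thesis unfolding poly_separated_def eventually_at_infinity_ray by blast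
qed

lemma ex_ray_poly_separated:
  assumes sparse: "poly_sparse Z" and "x < y"
  obtains \<theta> where "x < \<theta>" "\<theta> < y" "poly_separated (at_infinity_ray \<theta>) Z"
proof -
  obtain N where "AE s in lborel. \<forall>\<^sub>F m in sequentially. \<forall>a\<in>Z \<inter> cball 0 (real m + 2).
      2 / real m ^ N < \<bar>s - slope (a * cis (- x))\<bar>"
    using AE_slope_eventually_far[OF sparse] .
  then have "\<exists>s\<in>{0<..<min 1 (y - x)}. \<forall>\<^sub>F m in sequentially. \<forall>a\<in>Z \<inter> cball 0 (real m + 2).
      2 / real m ^ N < \<bar>s - slope (a * cis (- x))\<bar>"
    using \<open>x < y\<close> by (intro ex_in_open_of_AE_lborel) auto
  then obtain s where s_bounds: "0 < s" "s < 1" "s < y - x"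
    and far: "\<forall>\<^sub>F m in sequentially. \<forall>a\<in>Z \<inter> cball 0 (real m + 2).
      2 / real m ^ N < \<bar>s - slope (a * cis (- x))\<bar>"
    by auto
  have angle: "0 < arctan s" "arctan s \<le> pi / 4" "arctan s < y - x"
    using s_bounds arctan_le_self[of s] arctan_less_iff[of s 1] by (auto simp: arctan_one)
  have "poly_separated (at_infinity_ray (x + arctan s)) Z"
    using angle far by (intro poly_separated_ray_of_slopes_far[where N = N]) (auto simp: tan_arctan)
  then show ?thesis using angle by (intro that[of "x + arctan s"]) auto
qed

corollary closure_poly_separated_rays:
  assumes "poly_sparse Z"
  shows "closure {\<theta>. poly_separated (at_infinity_ray \<theta>) Z} = UNIV"
proof -
  have "\<theta>\<^sub>0 \<in> closure {\<theta>. poly_separated (at_infinity_ray \<theta>) Z}" for \<theta>\<^sub>0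
    unfolding closure_approachable
  proof (intro allI impI)
    fix e :: real assume "e > 0"
    then obtain \<theta> where "\<theta>\<^sub>0 < \<theta>" "\<theta> < \<theta>\<^sub>0 + e" "poly_separated (at_infinity_ray \<theta>) Z"
      using ex_ray_poly_separated[OF assms, of \<theta>\<^sub>0 "\<theta>\<^sub>0 + e"] by auto
    then show "\<exists>\<theta>\<in>{\<theta>. poly_separated (at_infinity_ray \<theta>) Z}. dist \<theta> \<theta>\<^sub>0 < e"
      by (intro bexI[of _ \<theta>]) (auto simp: dist_real_def)
  qed
  then show ?thesis by blast
qed

section \<open>Growth and zeros of entire functions\<close>

lemma continuous_exp_bound:
  fixes u :: "'a::{real_normed_vector,heine_borel} \<Rightarrow> 'b::real_normed_vector"
  assumes "closed S" "continuous_on S u"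
    and u_le_far: "\<And>z. z \<in> S \<Longrightarrow> b \<le> norm z \<Longrightarrow> norm (u z) \<le> exp (K * norm z powr s)"
  shows "\<exists>C>0. \<forall>z\<in>S. norm (u z) \<le> exp (C * (1 + norm z powr s))"
proof -
  have "compact (u ` (S \<inter> cball 0 b))"
    using assms(1,2)
    by (intro compact_continuous_image closed_Int_compact) (auto intro: continuous_on_subset)
  then obtain B where B_pos: "B > 0" and u_le: "\<And>z. z \<in> S \<Longrightarrow> norm z \<le> b \<Longrightarrow> norm (u z) \<le> B"
    using compact_imp_bounded[of "u ` (S \<inter> cball 0 b)"] unfolding bounded_pos by auto
  show ?thesis
  proof (intro exI[of _ "max K B"] conjI ballI)
    show "max K B > 0" using B_pos by simp
    fix z assume in_S: "z \<in> S"
    consider (near) "norm z \<le> b" | (far) "b \<le> norm z" by linarith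
    then show "norm (u z) \<le> exp (max K B * (1 + norm z powr s))"
    proof cases
      case near
      have "norm (u z) \<le> exp B" using u_le[OF in_S near] exp_ge_add_one_self[of B] by linarith
      also have "\<dots> \<le> exp (max K B * (1 + norm z powr s))"
        using B_pos mult_mono[of B "max K B" 1 "1 + norm z powr s"] by simp
      finally show ?thesis .
    next
      case far
      have "K * norm z powr s \<le> max K B * (1 + norm z powr s)"
        using B_pos mult_right_mono[of K "max K B" "norm z powr s"] by (simp add: distrib_left)
      then show ?thesis using u_le_far[OF in_S far] by (meson exp_le_cancel_iff order_trans)
    qed
  qed
qed

lemma entire_exp_bound:
  fixes F :: "complex \<Rightarrow> complex"
  assumes "F holomorphic_on UNIV" "exp_bounded s at_infinity F"
  shows "\<exists>C>0. \<forall>z. norm (F z) \<le> exp (C * (1 + norm z powr s))"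
proof -
  obtain K b where "\<And>z. b \<le> norm z \<Longrightarrow> norm (F z) \<le> exp (K * norm z powr s)"
    using assms(2) unfolding exp_bounded_def eventually_at_infinity by blast
  then have "\<exists>C>0. \<forall>z\<in>UNIV. norm (F z) \<le> exp (C * (1 + norm z powr s))"
    by (rule continuous_exp_bound[OF closed_UNIV holomorphic_on_imp_continuous_on[OF assms(1)]])
  then show ?thesis by simp
qed

lemma entire_exp_bound_on_ray:
  fixes F :: "complex \<Rightarrow> complex"
  assumes "F holomorphic_on UNIV" "exp_bounded s (at_infinity_ray \<theta>) F"
  shows "\<exists>C>0. \<forall>t\<ge>0. norm (F (rcis t \<theta>)) \<le> exp (C * (1 + t powr s))"
proof -
  obtain K b where far: "\<And>t. b \<le> t \<Longrightarrow> norm (F (rcis t \<theta>)) \<le> exp (K * \<bar>t\<bar> powr s)"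
    using assms(2) unfolding exp_bounded_def eventually_at_infinity_ray eventually_at_top_linorder
    by auto
  have "\<exists>C>0. \<forall>t\<in>{0..}. norm (F (rcis t \<theta>)) \<le> exp (C * (1 + norm t powr s))"
  proof (rule continuous_exp_bound[OF closed_atLeast])
    show "continuous_on {0..} (\<lambda>t. F (rcis t \<theta>))"
      using holomorphic_on_imp_continuous_on[OF assms(1)]
      by (rule continuous_on_compose2) (auto intro!: continuous_intros)
    show "norm (F (rcis t \<theta>)) \<le> exp (K * norm t powr s)" if "t \<in> {0..}" "b \<le> norm t" for t
      using far[of t] that by simp
  qed
  then show ?thesis by auto
qed

lemma exp_bounded_deriv:
  fixes F :: "complex \<Rightarrow> complex"
  assumes entire: "F holomorphic_on UNIV" "exp_bounded s at_infinity F" and s_nonneg: "s \<ge> 0"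
  shows "exp_bounded s at_infinity (deriv F)"
proof -
  obtain K where bound: "K > 0" "\<forall>\<^sub>F z in at_infinity. norm (F z) \<le> exp (K * norm z powr s)"
    using exp_boundedE[OF entire(2)] .
  then obtain b where far: "\<And>z. b \<le> norm z \<Longrightarrow> norm (F z) \<le> exp (K * norm z powr s)"
    unfolding eventually_at_infinity by blast
  have "norm (deriv F z) \<le> exp (K * 2 powr s * norm z powr s)"
    if z_large: "max 1 (b + 1) \<le> norm z" for z
  proof -
    have "norm ((deriv ^^ 1) F z) \<le> fact 1 * exp (K * (2 * norm z) powr s) / 1 ^ 1"
    proof (rule Cauchy_inequality)
      show "F holomorphic_on ball z 1" "continuous_on (cball z 1) F"
        using entire(1)
        by (auto intro: holomorphic_on_subset continuous_on_subset holomorphic_on_imp_continuous_on)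
      fix x assume "norm (z - x) = 1"
      then have x_norm: "b \<le> norm x" "norm x \<le> 2 * norm z"
        using z_large norm_triangle_ineq4[of z "z - x"] norm_triangle_ineq[of "z - x" x] by simp_all
      then have "norm x powr s \<le> (2 * norm z) powr s" using s_nonneg by (intro powr_mono2) auto
      then show "norm (F x) \<le> exp (K * (2 * norm z) powr s)"
        using far[OF x_norm(1)] bound(1)
        by (meson exp_le_cancel_iff mult_left_mono less_imp_le order_trans)
    qed simp
    then show ?thesis by (simp add: powr_mult mult.assoc)
  qed
  then show ?thesis unfolding exp_bounded_def eventually_at_infinity by blast
qed

lemma eventually_not_in_of_poly_separated:
  assumes "poly_separated G Z" "G \<le> at_infinity"
  shows "\<forall>\<^sub>F z in G. z \<notin> Z"
proof -
  obtain N where "\<forall>\<^sub>F z in G. \<forall>a\<in>Z. 1 / norm z ^ N \<le> dist z a"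
    using assms(1) unfolding poly_separated_def by blast
  then show ?thesis
    using eventually_norm_at_infinity[OF assms(2) eventually_gt_at_top[of 0]]
  proof eventually_elim
    case (elim z)
    then have "0 < 1 / norm z ^ N" by simp
    then show ?case using elim(1) by fastforce
  qed
qed

context
  fixes F :: "complex \<Rightarrow> complex" and z0 :: complex and s :: real
  assumes hol: "F holomorphic_on UNIV" and bounded: "exp_bounded s at_infinity F"
    and nonzero: "F z0 \<noteq> 0" and s_pos: "s > 0"
begin

lemma eventually_entire_bounded_on_sphere:
  obtains C where "\<forall>\<^sub>F r in at_top. entire_bounded_on_sphere F z0 (32 * r) (C * r powr s)"
proof -
  obtain K where bound: "K > 0" "\<forall>\<^sub>F z in at_infinity. norm (F z) \<le> exp (K * norm z powr s)"
    using exp_boundedE[OF bounded] .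
  then obtain b where far: "\<And>z. b \<le> norm z \<Longrightarrow> norm (F z) \<le> exp (K * norm z powr s)"
    unfolding eventually_at_infinity by blast
  have "\<forall>\<^sub>F r in at_top. exp (- (r powr s)) \<le> norm (F z0)"
    using s_pos nonzero by real_asymp
  then have "\<forall>\<^sub>F r in at_top.
      entire_bounded_on_sphere F z0 (32 * r) ((K * 33 powr s + 1) * r powr s)"
    using eventually_ge_at_top[of "max 1 (max (norm z0) b)"]
  proof eventually_elim
    case (elim r)
    show ?case
    proof
      fix w assume "w \<in> sphere z0 (32 * r)"
      then have "norm (w - z0) = 32 * r" by (simp add: dist_norm norm_minus_commute)
      then have w_norm: "b \<le> norm w" "norm w \<le> 33 * r"
        using elim(2) norm_triangle_ineq[of "w - z0" z0] norm_triangle_ineq4[of w z0] by simp_all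
      then have "norm w powr s \<le> (33 * r) powr s" using s_pos by (intro powr_mono2) auto
      then have "norm (F w) \<le> exp (K * (33 * r) powr s)"
        using far[OF w_norm(1)] bound(1)
        by (meson exp_le_cancel_iff mult_left_mono less_imp_le order_trans)
      also have "\<dots> = exp ((K * 33 powr s + 1) * r powr s) * exp (- (r powr s))"
        using elim(2) by (simp add: exp_add[symmetric] powr_mult algebra_simps)
      also have "\<dots> \<le> exp ((K * 33 powr s + 1) * r powr s) * norm (F z0)"
        using elim(1) by (intro mult_left_mono) auto
      finally show "norm (F w) \<le> exp ((K * 33 powr s + 1) * r powr s) * norm (F z0)" .
    qed (use hol nonzero elim(2) in auto)
  qed
  then show ?thesis by (rule that)
qed

lemma poly_sparse_zeros: "poly_sparse {a. F a = 0}"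
proof -
  obtain C where on_spheres: "\<forall>\<^sub>F r in at_top. entire_bounded_on_sphere F z0 (32 * r) (C * r powr s)"
    using eventually_entire_bounded_on_sphere .
  define N where "N = nat \<lceil>s\<rceil> + 1"
  have "s < real N" unfolding N_def by linarith
  then have "\<forall>\<^sub>F r in at_top. C * r powr s \<le> r ^ N" by real_asymp
  with on_spheres have "\<forall>\<^sub>F r in at_top. finite ({a. F a = 0} \<inter> cball 0 r) \<and>
      real (card ({a. F a = 0} \<inter> cball 0 r)) \<le> r ^ N"
    using eventually_ge_at_top[of "norm z0"]
  proof eventually_elim
    case (elim r)
    interpret entire_bounded_on_sphere F z0 "32 * r" "C * r powr s" by fact
    have subset: "{a. F a = 0} \<inter> cball 0 r \<subseteq> {a \<in> cball z0 (32 * r / 4). F a = 0}"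
    proof
      fix a assume a_zero: "a \<in> {a. F a = 0} \<inter> cball 0 r"
      then show "a \<in> {a \<in> cball z0 (32 * r / 4). F a = 0}"
        using elim(3) norm_triangle_ineq4[of z0 a] radius_pos by (simp add: dist_norm)
    qed
    from card_mono[OF card_zeros_le(1) subset] card_zeros_le(2) elim(2)
    have "real (card ({a. F a = 0} \<inter> cball 0 r)) \<le> r ^ N" by linarith
    then show ?case using finite_subset[OF subset card_zeros_le(1)] by blast
  qed
  then show ?thesis unfolding poly_sparse_def by blast
qed

lemma estimates_of_poly_separated_zeros:
  assumes to_infinity: "G \<le> at_infinity" and sep: "poly_separated G {a. F a = 0}"
  obtains C N where
    "\<forall>\<^sub>F z in G. norm (deriv F z)
       \<le> (C * norm z powr s * norm z ^ N + (C * norm z powr s + 1) / norm z) * norm (F z)"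
    "\<forall>\<^sub>F z in G. exp (- (C * norm z powr s * ln (8 * norm z * norm z ^ N)
       + 2 * (C * norm z powr s + 1))) * norm (F z0) \<le> norm (F z)"
proof -
  obtain C where on_spheres: "\<forall>\<^sub>F r in at_top. entire_bounded_on_sphere F z0 (32 * r) (C * r powr s)"
    using eventually_entire_bounded_on_sphere .
  obtain N where separated: "\<forall>\<^sub>F z in G. \<forall>a\<in>{a. F a = 0}. 1 / norm z ^ N \<le> dist z a"
    using sep unfolding poly_separated_def by blast
  have "\<forall>\<^sub>F z in G.
      norm (deriv F z)
        \<le> (C * norm z powr s * norm z ^ N + (C * norm z powr s + 1) / norm z) * norm (F z) \<and>
      exp (- (C * norm z powr s * ln (8 * norm z * norm z ^ N) + 2 * (C * norm z powr s + 1)))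
        * norm (F z0) \<le> norm (F z)"
    using eventually_norm_at_infinity[OF to_infinity on_spheres] separated
      eventually_norm_at_infinity[OF to_infinity eventually_ge_at_top[of "max 1 (norm z0)"]]
  proof eventually_elim
    case (elim z)
    interpret entire_bounded_on_sphere F z0 "32 * norm z" "C * norm z powr s" by fact
    define d where "d = 1 / norm z ^ N"
    have in_disc: "z \<in> cball z0 (32 * norm z / 16)"
      using elim(3) norm_triangle_ineq4[of z0 z] by (simp add: dist_norm)
    have "1 \<le> norm z ^ N" using elim(3) by (simp add: one_le_power)
    then have d_bounds: "0 < d" "d \<le> 1" unfolding d_def
      by (simp_all only: zero_less_divide_1_iff divide_le_eq_1_pos less_le_trans[OF zero_less_one])
    then have "d \<le> 32 * norm z / 4" using elim(3) by simp
    have away: "\<And>a. F a = 0 \<Longrightarrow> d \<le> norm (z - a)"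
      using elim(2) by (simp add: d_def dist_norm)
    have d_eq: "C * norm z powr s / d = C * norm z powr s * norm z ^ N"
      "32 * norm z / (4 * d) = 8 * norm z * norm z ^ N"
      by (simp_all add: d_def)
    have radius_eq: "32 * (C * norm z powr s + 1) / (32 * norm z)
        = (C * norm z powr s + 1) / norm z"
      by (rule mult_divide_mult_cancel_left) simp
    show ?case
      using norm_deriv_le_away_from_zeros[OF in_disc d_bounds(1) away]
        norm_ge_away_from_zeros[OF in_disc d_bounds(1) away \<open>d \<le> 32 * norm z / 4\<close>]
      unfolding d_eq radius_eq by (rule conjI)
  qed
  then show ?thesis unfolding eventually_conj_iff using that by blast
qed

lemma exp_bounded_logarithmic_derivative:
  assumes "G \<le> at_infinity" "poly_separated G {a. F a = 0}" "\<epsilon> > 0"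
  shows "exp_bounded \<epsilon> G (\<lambda>z. deriv F z / F z)"
proof -
  obtain C N where deriv_le: "\<forall>\<^sub>F z in G. norm (deriv F z)
       \<le> (C * norm z powr s * norm z ^ N + (C * norm z powr s + 1) / norm z) * norm (F z)"
    using estimates_of_poly_separated_zeros[OF assms(1,2)] .
  have "\<forall>\<^sub>F r in at_top. C * r powr s * r ^ N + (C * r powr s + 1) / r \<le> exp (r powr \<epsilon>)"
    using \<open>\<epsilon> > 0\<close> by real_asymp
  from eventually_norm_at_infinity[OF assms(1) this] deriv_le
    eventually_not_in_of_poly_separated[OF assms(2,1)]
  have "\<forall>\<^sub>F z in G. norm (deriv F z / F z) \<le> exp (1 * norm z powr \<epsilon>)"
  proof eventually_elim
    case (elim z)
    then have "norm (deriv F z) \<le> exp (norm z powr \<epsilon>) * norm (F z)"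
      by (meson mult_right_mono norm_ge_zero order_trans)
    then show ?case using elim(3) by (simp add: norm_divide pos_divide_le_eq)
  qed
  then show ?thesis unfolding exp_bounded_def by blast
qed

lemma exp_bounded_inverse:
  assumes "G \<le> at_infinity" "poly_separated G {a. F a = 0}" "s < s'"
  shows "exp_bounded s' G (\<lambda>z. inverse (F z))"
proof -
  obtain C N where norm_ge: "\<forall>\<^sub>F z in G. exp (- (C * norm z powr s * ln (8 * norm z * norm z ^ N)
       + 2 * (C * norm z powr s + 1))) * norm (F z0) \<le> norm (F z)"
    using estimates_of_poly_separated_zeros[OF assms(1,2)] .
  define D where "D = ln (norm (F z0))"
  have norm_eq: "norm (F z0) = exp D" using nonzero by (simp add: D_def)
  have "\<forall>\<^sub>F r in at_top. C * r powr s * ln (8 * r * r ^ N) + 2 * (C * r powr s + 1) - D \<le> r powr s'"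
    using s_pos \<open>s < s'\<close> by real_asymp
  from eventually_norm_at_infinity[OF assms(1) this] norm_ge
  have "\<forall>\<^sub>F z in G. norm (inverse (F z)) \<le> exp (1 * norm z powr s')"
  proof eventually_elim
    case (elim z)
    have "exp (- (norm z powr s')) \<le> norm (F z)"
      using elim unfolding norm_eq exp_add[symmetric] by (smt (verit) exp_le_cancel_iff)
    then have "norm (inverse (F z)) \<le> inverse (exp (- (norm z powr s')))"
      unfolding norm_inverse by (rule le_imp_inverse_le) simp
    then show ?case by (simp add: exp_minus)
  qed
  then show ?thesis unfolding exp_bounded_def by blast
qed

end

section \<open>The Phragmen--Lindelof principle\<close>

lemma cos_le_cos_of_abs_le:
  assumes "\<bar>x\<bar> \<le> y" "y \<le> pi"
  shows "cos y \<le> cos x"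
  using cos_monotone_0_pi_le[of "\<bar>x\<bar>" y] assms by simp

definition strip_damping :: "real \<Rightarrow> real \<Rightarrow> complex \<Rightarrow> complex" where
  "strip_damping \<kappa> e w = exp (- (of_real e * (exp (of_real \<kappa> * w) + exp (- (of_real \<kappa> * w)))))"

lemma norm_strip_damping_le:
  assumes "0 \<le> \<kappa>" "\<kappa> * \<beta> < pi / 2" "0 \<le> e" "\<bar>Im w\<bar> \<le> \<beta>"
  shows "norm (strip_damping \<kappa> e w) \<le> exp (- (e * cos (\<kappa> * \<beta>) * exp (\<kappa> * \<bar>Re w\<bar>)))"
proof -
  have "\<bar>\<kappa> * Im w\<bar> \<le> \<kappa> * \<beta>" using assms by (simp add: abs_mult mult_left_mono)
  then have "cos (\<kappa> * \<beta>) \<le> cos (\<kappa> * Im w)" "0 \<le> cos (\<kappa> * Im w)"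
    using assms(2) by (auto intro!: cos_le_cos_of_abs_le cos_ge_zero simp: abs_le_iff)
  then have "cos (\<kappa> * \<beta>) * exp (\<kappa> * \<bar>Re w\<bar>)
      \<le> cos (\<kappa> * Im w) * (exp (\<kappa> * Re w) + exp (- (\<kappa> * Re w)))"
    by (intro mult_mono) (auto simp: abs_if)
  also have "\<dots> = Re (exp (of_real \<kappa> * w) + exp (- (of_real \<kappa> * w)))"
    by (simp add: Re_exp algebra_simps)
  finally show ?thesis
    using mult_left_mono[OF _ \<open>0 \<le> e\<close>] by (simp add: strip_damping_def mult.assoc)
qed

lemma maximum_modulus_centred_rectangle:
  assumes hol: "G holomorphic_on {w. \<bar>Im w\<bar> < \<beta>}" and cont: "continuous_on {w. \<bar>Im w\<bar> \<le> \<beta>} G"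
    and sides: "\<And>w. \<bar>Im w\<bar> \<le> \<beta> \<Longrightarrow> \<bar>Im w\<bar> = \<beta> \<or> \<bar>Re w\<bar> = b \<Longrightarrow> norm (G w) \<le> M"
    and inside: "\<bar>Im w\<bar> \<le> \<beta>" "\<bar>Re w\<bar> \<le> b"
  shows "norm (G w) \<le> M"
proof -
  define S where "S = cbox (Complex (- b) (- \<beta>)) (Complex b \<beta>)"
  show ?thesis
  proof (rule maximum_modulus_frontier[of G S])
    have "interior S \<subseteq> {w. \<bar>Im w\<bar> < \<beta>}" "closure S \<subseteq> {w. \<bar>Im w\<bar> \<le> \<beta>}"
      by (auto simp: S_def interior_cbox in_box_complex_iff in_cbox_complex_iff)
    then show "G holomorphic_on interior S" "continuous_on (closure S) G"
      using hol cont by (auto intro: holomorphic_on_subset continuous_on_subset)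
    show "bounded S" by (simp add: S_def)
    show "w \<in> S" using inside by (auto simp: S_def in_cbox_complex_iff)
    fix v assume "v \<in> frontier S"
    then show "norm (G v) \<le> M"
      by (intro sides) (auto simp: S_def frontier_cbox in_cbox_complex_iff in_box_complex_iff)
  qed
qed

text \<open>For \<open>\<kappa> > \<tau>\<close> the damped function is small on the vertical sides of large rectangles.\<close>

lemma phragmen_lindelof_strip_damped:
  assumes hol: "G holomorphic_on {w. \<bar>Im w\<bar> < \<beta>}" and cont: "continuous_on {w. \<bar>Im w\<bar> \<le> \<beta>} G"
    and growth: "\<And>w. \<bar>Im w\<bar> \<le> \<beta> \<Longrightarrow> norm (G w) \<le> exp (K * exp (\<tau> * \<bar>Re w\<bar>))"
    and boundary: "\<And>w. \<bar>Im w\<bar> = \<beta> \<Longrightarrow> norm (G w) \<le> M"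
    and par: "0 < \<tau>" "\<tau> < \<kappa>" "\<kappa> * \<beta> < pi / 2" "0 < \<beta>" "0 < M" "0 < e"
    and in_strip: "\<bar>Im w\<bar> \<le> \<beta>"
  shows "norm (G w * strip_damping \<kappa> e w) \<le> M"
proof -
  define c where "c = cos (\<kappa> * \<beta>)"
  have c_pos: "0 < c"
    unfolding c_def using par by (intro cos_gt_zero_pi) (auto intro: less_trans[of _ 0])
  have damping_le: "norm (strip_damping \<kappa> e v) \<le> exp (- (e * c * exp (\<kappa> * \<bar>Re v\<bar>)))"
    if "\<bar>Im v\<bar> \<le> \<beta>" for v
    unfolding c_def using par that by (intro norm_strip_damping_le) auto
  have "\<forall>\<^sub>F b in at_top. exp (K * exp (\<tau> * b) - e * c * exp (\<kappa> * b)) \<le> M"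
    using par c_pos by real_asymp
  with eventually_ge_at_top[of "\<bar>Re w\<bar>"]
  have "\<forall>\<^sub>F b in at_top. \<bar>Re w\<bar> \<le> b \<and> exp (K * exp (\<tau> * b) - e * c * exp (\<kappa> * b)) \<le> M"
    by (rule eventually_conj)
  then obtain b where b_large: "\<bar>Re w\<bar> \<le> b" "exp (K * exp (\<tau> * b) - e * c * exp (\<kappa> * b)) \<le> M"
    using eventually_happens by force
  show ?thesis
  proof (rule maximum_modulus_centred_rectangle[OF _ _ _ in_strip b_large(1)])
    show "(\<lambda>w. G w * strip_damping \<kappa> e w) holomorphic_on {w. \<bar>Im w\<bar> < \<beta>}"
      "continuous_on {w. \<bar>Im w\<bar> \<le> \<beta>} (\<lambda>w. G w * strip_damping \<kappa> e w)"
      unfolding strip_damping_def using hol cont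
      by (auto intro!: holomorphic_intros continuous_intros)
    fix v assume v_strip: "\<bar>Im v\<bar> \<le> \<beta>" and "\<bar>Im v\<bar> = \<beta> \<or> \<bar>Re v\<bar> = b"
    from this(2) have "norm (G v) * norm (strip_damping \<kappa> e v) \<le> M"
    proof
      assume "\<bar>Im v\<bar> = \<beta>"
      have "norm (strip_damping \<kappa> e v) \<le> 1"
        by (rule order_trans[OF damping_le[OF v_strip]]) (use c_pos par in simp)
      then have "norm (G v) * norm (strip_damping \<kappa> e v) \<le> M * 1"
        using boundary[OF \<open>\<bar>Im v\<bar> = \<beta>\<close>] par by (intro mult_mono) auto
      then show ?thesis by simp
    next
      assume "\<bar>Re v\<bar> = b"
      then have "norm (G v) * norm (strip_damping \<kappa> e v)
          \<le> exp (K * exp (\<tau> * b)) * exp (- (e * c * exp (\<kappa> * b)))"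
        using growth[OF v_strip] damping_le[OF v_strip] by (intro mult_mono) auto
      also have "\<dots> \<le> M" using b_large(2) by (simp add: exp_add[symmetric])
      finally show ?thesis .
    qed
    then show "norm (G v * strip_damping \<kappa> e v) \<le> M" by (simp add: norm_mult)
  qed
qed

theorem phragmen_lindelof_strip:
  assumes hol: "G holomorphic_on {w. \<bar>Im w\<bar> < \<beta>}" and cont: "continuous_on {w. \<bar>Im w\<bar> \<le> \<beta>} G"
    and growth: "\<And>w. \<bar>Im w\<bar> \<le> \<beta> \<Longrightarrow> norm (G w) \<le> exp (K * exp (\<tau> * \<bar>Re w\<bar>))"
    and boundary: "\<And>w. \<bar>Im w\<bar> = \<beta> \<Longrightarrow> norm (G w) \<le> M"
    and par: "0 < \<tau>" "\<tau> * \<beta> < pi / 2" "0 < \<beta>" "0 < M" and in_strip: "\<bar>Im w\<bar> \<le> \<beta>"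
  shows "norm (G w) \<le> M"
proof -
  obtain \<kappa> where kappa_bounds: "\<tau> < \<kappa>" "\<kappa> * \<beta> < pi / 2"
    using dense[of \<tau> "pi / 2 / \<beta>"] par by (auto simp: pos_less_divide_eq)
  show ?thesis
  proof (rule tendsto_upperbound)
    show "((\<lambda>e. norm (G w * strip_damping \<kappa> e w)) \<longlongrightarrow> norm (G w)) (at_right 0)"
      unfolding strip_damping_def by (auto intro!: tendsto_eq_intros)
    show "\<forall>\<^sub>F e in at_right 0. norm (G w * strip_damping \<kappa> e w) \<le> M"
      using eventually_at_right_less[of 0]
    proof eventually_elim
      case (elim e)
      show ?case
        by (rule phragmen_lindelof_strip_damped
            [OF hol cont growth boundary par(1) kappa_bounds par(3,4) elim in_strip])
    qed
  qed simp
qed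

corollary phragmen_lindelof_strip_exp:
  assumes hol: "f holomorphic_on {w. \<bar>Im w\<bar> < \<beta>}" and cont: "continuous_on {w. \<bar>Im w\<bar> \<le> \<beta>} f"
    and growth: "\<And>w. \<bar>Im w\<bar> \<le> \<beta> \<Longrightarrow> norm (f w) \<le> exp (C * exp (\<tau> * \<bar>Re w\<bar>))"
    and boundary: "\<And>w. \<bar>Im w\<bar> = \<beta> \<Longrightarrow> norm (f w) \<le> exp (K * (1 + exp (s * Re w)))"
    and par: "0 < \<tau>" "\<tau> * \<beta> < pi / 2" "0 < s" "s * \<beta> < pi / 2" "0 < \<beta>" "0 \<le> K"
    and in_strip: "\<bar>Im w\<bar> \<le> \<beta>"
  shows "norm (f w) \<le> exp (K + K / cos (s * \<beta>) * exp (s * Re w))"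
proof -
  define c where "c = cos (s * \<beta>)"
  define g where "g w = f w * exp (- (of_real (K / c) * exp (of_real s * w)))" for w
  have c_pos: "0 < c"
    unfolding c_def using par by (intro cos_gt_zero_pi) (auto intro: less_trans[of _ 0])
  have norm_g: "norm (g w) = norm (f w) * exp (- (K / c * (exp (s * Re w) * cos (s * Im w))))" for w
    by (simp add: g_def norm_mult Re_exp)
  have cos_ge: "c \<le> cos (s * Im v)" if "\<bar>Im v\<bar> \<le> \<beta>" for v
    unfolding c_def using that par pi_gt_zero
    by (intro cos_le_cos_of_abs_le) (simp add: abs_mult, linarith)
  have "norm (g w) \<le> exp K"
  proof (rule phragmen_lindelof_strip[where G = g and w = w and \<tau> = \<tau> and \<beta> = \<beta>])
    show "g holomorphic_on {w. \<bar>Im w\<bar> < \<beta>}" "continuous_on {w. \<bar>Im w\<bar> \<le> \<beta>} g"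
      unfolding g_def[abs_def] using hol cont c_pos
      by (auto intro!: holomorphic_intros continuous_intros)
    show "norm (g v) \<le> exp (C * exp (\<tau> * \<bar>Re v\<bar>))" if v_strip: "\<bar>Im v\<bar> \<le> \<beta>" for v
    proof -
      have "0 \<le> K / c * (exp (s * Re v) * cos (s * Im v))"
        using cos_ge[OF v_strip] c_pos par by simp
      then have "norm (g v) \<le> norm (f v) * 1" unfolding norm_g by (intro mult_left_mono) auto
      then show ?thesis using growth[OF v_strip] by simp
    qed
    show "norm (g v) \<le> exp K" if v_strip: "\<bar>Im v\<bar> = \<beta>" for v
    proof -
      have "K * exp (s * Re v) = K / c * (exp (s * Re v) * c)" using c_pos by simp
      also have "\<dots> \<le> K / c * (exp (s * Re v) * cos (s * Im v))"
        using cos_ge[of v] v_strip c_pos par by (intro mult_left_mono) auto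
      finally have "exp (K * (1 + exp (s * Re v))) *
          exp (- (K / c * (exp (s * Re v) * cos (s * Im v)))) \<le> exp K"
        unfolding exp_add[symmetric] exp_le_cancel_iff by (simp add: distrib_left)
      then show ?thesis
        using mult_right_mono[OF boundary[OF v_strip]] unfolding norm_g
        by (rule order_trans[rotated]) simp
    qed
  qed (use par in_strip in auto)
  then have "norm (f w) \<le> exp K * exp (K / c * (exp (s * Re w) * cos (s * Im w)))"
    unfolding norm_g by (simp add: exp_minus field_simps)
  also have "\<dots> \<le> exp K * exp (K / c * (exp (s * Re w) * 1))"
    using c_pos par by (intro mult_left_mono iffD2[OF exp_le_cancel_iff]) auto
  finally show ?thesis by (simp add: exp_add c_def)
qed

text \<open>The logarithm maps the sector to a strip.\<close>

theorem phragmen_lindelof_sector: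
  fixes F :: "complex \<Rightarrow> complex"
  assumes hol: "F holomorphic_on {rcis t \<theta> |t \<theta>. 0 < t \<and> \<theta>1 < \<theta> \<and> \<theta> < \<theta>2}"
    and cont: "continuous_on {rcis t \<theta> |t \<theta>. 0 < t \<and> \<theta>1 \<le> \<theta> \<and> \<theta> \<le> \<theta>2} F"
    and growth: "\<And>t \<theta>. 0 < t \<Longrightarrow> \<theta>1 \<le> \<theta> \<Longrightarrow> \<theta> \<le> \<theta>2 \<Longrightarrow> norm (F (rcis t \<theta>)) \<le> exp (C * (1 + t powr \<tau>))"
    and rays: "\<And>t. 0 < t \<Longrightarrow> norm (F (rcis t \<theta>1)) \<le> exp (K * (1 + t powr s))"
      "\<And>t. 0 < t \<Longrightarrow> norm (F (rcis t \<theta>2)) \<le> exp (K * (1 + t powr s))"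
    and par: "0 \<le> C" "0 \<le> K" "0 < \<tau>" "0 < s" "\<theta>1 < \<theta>2" "\<tau> * (\<theta>2 - \<theta>1) < pi" "s * (\<theta>2 - \<theta>1) < pi"
    and in_sector: "0 < t" "\<theta>1 \<le> \<theta>" "\<theta> \<le> \<theta>2"
  shows "norm (F (rcis t \<theta>)) \<le> exp (K + K / cos (s * ((\<theta>2 - \<theta>1) / 2)) * t powr s)"
proof -
  define \<beta> where "\<beta> = (\<theta>2 - \<theta>1) / 2"
  define \<phi> where "\<phi> = (\<theta>1 + \<theta>2) / 2"
  define E where "E w = rcis (exp (Re w)) (Im w + \<phi>)" for w
  have E_exp: "E = (\<lambda>w. exp (w + \<i> * of_real \<phi>))"
    by (simp add: E_def fun_eq_iff exp_eq_polar rcis_def)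
  have half_opening: "\<beta> > 0" "\<tau> * \<beta> < pi / 2" "s * \<beta> < pi / 2" and bounds: "\<theta>1 = \<phi> - \<beta>" "\<theta>2 = \<phi> + \<beta>"
    using par by (auto simp: \<beta>_def \<phi>_def field_simps)
  have "norm ((F \<circ> E) (Complex (ln t) (\<theta> - \<phi>)))
      \<le> exp (K + K / cos (s * \<beta>) * exp (s * Re (Complex (ln t) (\<theta> - \<phi>))))"
  proof (rule phragmen_lindelof_strip_exp)
    have "E ` {w. \<bar>Im w\<bar> < \<beta>} \<subseteq> {rcis t \<theta> |t \<theta>. 0 < t \<and> \<theta>1 < \<theta> \<and> \<theta> < \<theta>2}"
      unfolding E_def bounds by (force simp: abs_less_iff)
    then show "F \<circ> E holomorphic_on {w. \<bar>Im w\<bar> < \<beta>}"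
      by (intro holomorphic_on_compose_gen[OF _ hol]) (auto simp: E_exp intro!: holomorphic_intros)
    have "E ` {w. \<bar>Im w\<bar> \<le> \<beta>} \<subseteq> {rcis t \<theta> |t \<theta>. 0 < t \<and> \<theta>1 \<le> \<theta> \<and> \<theta> \<le> \<theta>2}"
      unfolding E_def bounds by (force simp: abs_le_iff)
    then show "continuous_on {w. \<bar>Im w\<bar> \<le> \<beta>} (F \<circ> E)"
      by (intro continuous_on_compose continuous_on_subset[OF cont])
        (auto simp: E_exp intro!: continuous_intros)
    show "norm ((F \<circ> E) v) \<le> exp (C * 2 * exp (\<tau> * \<bar>Re v\<bar>))" if v_strip: "\<bar>Im v\<bar> \<le> \<beta>" for v
    proof -
      have "norm ((F \<circ> E) v) \<le> exp (C * (1 + exp (\<tau> * Re v)))"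
        using growth[of "exp (Re v)" "Im v + \<phi>"] v_strip
        by (simp add: E_def bounds powr_def abs_le_iff)
      also have "C * (1 + exp (\<tau> * Re v)) \<le> C * (exp (\<tau> * \<bar>Re v\<bar>) + exp (\<tau> * \<bar>Re v\<bar>))"
        using par by (intro mult_left_mono add_mono) auto
      finally show ?thesis by (simp add: mult.assoc)
    qed
    show "norm ((F \<circ> E) v) \<le> exp (K * (1 + exp (s * Re v)))" if v_strip: "\<bar>Im v\<bar> = \<beta>" for v
    proof -
      have "Im v + \<phi> = \<theta>1 \<or> Im v + \<phi> = \<theta>2"
        using v_strip half_opening(1) by (auto simp: bounds abs_if split: if_splits)
      then show ?thesis using rays[of "exp (Re v)"] by (auto simp: E_def powr_def)
    qed
  qed (use par half_opening in_sector in \<open>auto simp: bounds\<close>)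
  then show ?thesis using in_sector(1) by (simp add: E_def \<beta>_def powr_def)
qed

corollary entire_phragmen_lindelof_sector:
  fixes F :: "complex \<Rightarrow> complex"
  assumes entire: "F holomorphic_on UNIV" "exp_bounded \<tau> at_infinity F"
    and rays: "exp_bounded s (at_infinity_ray \<theta>1) F" "exp_bounded s (at_infinity_ray \<theta>2) F"
    and par: "0 < s" "s \<le> \<tau>" "\<theta>1 < \<theta>2" "\<tau> * (\<theta>2 - \<theta>1) < pi"
  shows "\<exists>B. \<forall>t\<ge>1. \<forall>\<theta>\<in>{\<theta>1..\<theta>2}. norm (F (rcis t \<theta>)) \<le> exp (B * t powr s)"
proof -
  obtain C where global_bound: "C > 0" "\<forall>z. norm (F z) \<le> exp (C * (1 + norm z powr \<tau>))"
    using entire_exp_bound[OF entire] by blast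
  obtain K1 where ray1_bound: "K1 > 0" "\<forall>t\<ge>0. norm (F (rcis t \<theta>1)) \<le> exp (K1 * (1 + t powr s))"
    using entire_exp_bound_on_ray[OF entire(1) rays(1)] by blast
  obtain K2 where ray2_bound: "K2 > 0" "\<forall>t\<ge>0. norm (F (rcis t \<theta>2)) \<le> exp (K2 * (1 + t powr s))"
    using entire_exp_bound_on_ray[OF entire(1) rays(2)] by blast
  define K where "K = max K1 K2"
  have K_ge: "exp (K1 * (1 + t powr s)) \<le> exp (K * (1 + t powr s))"
    "exp (K2 * (1 + t powr s)) \<le> exp (K * (1 + t powr s))" for t
    by (simp_all add: K_def mult_right_mono add_nonneg_nonneg)
  have "s * (\<theta>2 - \<theta>1) \<le> \<tau> * (\<theta>2 - \<theta>1)" using par by (intro mult_right_mono) auto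
  then have s_opening: "s * (\<theta>2 - \<theta>1) < pi" using par(4) by linarith
  let ?k = "K / cos (s * ((\<theta>2 - \<theta>1) / 2))"
  have "norm (F (rcis t \<theta>)) \<le> exp ((K + ?k) * t powr s)"
    if in_sector: "t \<ge> 1" "\<theta> \<in> {\<theta>1..\<theta>2}" for t \<theta>
  proof -
    have "norm (F (rcis t \<theta>)) \<le> exp (K + ?k * t powr s)"
    proof (rule phragmen_lindelof_sector[where C = C and \<tau> = \<tau>])
      show "F holomorphic_on {rcis t \<theta> |t \<theta>. 0 < t \<and> \<theta>1 < \<theta> \<and> \<theta> < \<theta>2}"
        "continuous_on {rcis t \<theta> |t \<theta>. 0 < t \<and> \<theta>1 \<le> \<theta> \<and> \<theta> \<le> \<theta>2} F"
        using entire(1) by (auto intro: holomorphic_on_subset holomorphic_on_imp_continuous_on)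
      show "norm (F (rcis t \<theta>)) \<le> exp (C * (1 + t powr \<tau>))" if "0 < t" for t \<theta>
        using global_bound(2)[rule_format, of "rcis t \<theta>"] that by simp
      show "norm (F (rcis t \<theta>1)) \<le> exp (K * (1 + t powr s))"
        "norm (F (rcis t \<theta>2)) \<le> exp (K * (1 + t powr s))" if "0 < t" for t
        using ray1_bound(2) ray2_bound(2) K_ge that by (meson less_imp_le order_trans)+
    qed (use in_sector par s_opening global_bound(1) ray1_bound(1) in \<open>auto simp: K_def\<close>)
    also have "K + ?k * t powr s \<le> (K + ?k) * t powr s"
      using in_sector ray1_bound(1) par(1) mult_left_mono[of 1 "t powr s" K]
      by (simp add: K_def ge_one_powr_ge_zero distrib_right)
    finally show ?thesis by simp
  qed
  then show ?thesis by blast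
qed

corollary exp_bounded_of_rays:
  fixes F :: "complex \<Rightarrow> complex"
  assumes entire: "F holomorphic_on UNIV" "exp_bounded \<tau> at_infinity F"
    and exponents: "0 < s" "s \<le> \<tau>"
    and rays: "\<And>\<theta>. \<exists>\<theta>1 \<theta>2. \<theta>1 < \<theta> \<and> \<theta> < \<theta>2 \<and> \<tau> * (\<theta>2 - \<theta>1) < pi \<and>
      exp_bounded s (at_infinity_ray \<theta>1) F \<and> exp_bounded s (at_infinity_ray \<theta>2) F"
  shows "exp_bounded s at_infinity F"
proof -
  have "\<exists>U B. open U \<and> \<theta> \<in> U \<and> (\<forall>t\<ge>1. \<forall>\<theta>'\<in>U. norm (F (rcis t \<theta>')) \<le> exp (B * t powr s))" for \<theta>
  proof -
    obtain \<theta>1 \<theta>2 where sector: "\<theta>1 < \<theta>" "\<theta> < \<theta>2" "\<tau> * (\<theta>2 - \<theta>1) < pi"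
      "exp_bounded s (at_infinity_ray \<theta>1) F" "exp_bounded s (at_infinity_ray \<theta>2) F"
      using rays by blast
    then obtain B where "\<forall>t\<ge>1. \<forall>\<theta>'\<in>{\<theta>1..\<theta>2}. norm (F (rcis t \<theta>')) \<le> exp (B * t powr s)"
      using entire_phragmen_lindelof_sector[OF entire sector(4,5) exponents] by auto
    then show ?thesis using sector by (intro exI[of _ "{\<theta>1<..<\<theta>2}"] exI[of _ B]) auto
  qed
  then obtain U B where cover: "\<And>\<theta>. open (U \<theta>)" "\<And>\<theta>. \<theta> \<in> U \<theta>"
    and local_bound: "\<And>\<theta> t \<theta>'. t \<ge> 1 \<Longrightarrow> \<theta>' \<in> U \<theta> \<Longrightarrow> norm (F (rcis t \<theta>')) \<le> exp (B \<theta> * t powr s)"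
    by metis
  have "{0..2 * pi} \<subseteq> (\<Union>\<theta>\<in>UNIV. U \<theta>)" using cover(2) by auto
  then obtain D where finite_cover: "finite D" "{0..2 * pi} \<subseteq> (\<Union>\<theta>\<in>D. U \<theta>)"
    using compactE_image[OF compact_Icc, of UNIV U 0 "2 * pi"] cover(1) by auto
  have "norm (F z) \<le> exp (Max (B ` D) * norm z powr s)" if z_ge_1: "1 \<le> norm z" for z
  proof -
    have "Arg2pi z \<in> {0..2 * pi}" using Arg2pi_ge_0[of z] Arg2pi_lt_2pi[of z] by simp
    then obtain \<theta> where sector: "\<theta> \<in> D" "Arg2pi z \<in> U \<theta>" using finite_cover(2) by blast
    have "rcis (norm z) (Arg2pi z) = z"
      using Arg2pi_eq[of z] by (simp add: rcis_def cis_conv_exp)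
    then have "norm (F z) \<le> exp (B \<theta> * norm z powr s)"
      using local_bound[OF z_ge_1 sector(2)] by simp
    also have "\<dots> \<le> exp (Max (B ` D) * norm z powr s)"
      using sector(1) finite_cover(1) by (simp add: mult_right_mono)
    finally show ?thesis .
  qed
  then show ?thesis unfolding exp_bounded_def eventually_at_infinity by blast
qed

section \<open>Order\<close>

lemma logp_mono: "x \<le> y \<Longrightarrow> logp x \<le> logp y"
  by (auto simp: logp_def)

lemma le_exp_logp: "x \<le> exp (logp x)"
  by (auto simp: logp_def)

lemma norm_le_max_mod:
  assumes "g holomorphic_on UNIV"
  shows "norm (g z) \<le> max_mod (norm z) g"
  unfolding max_mod_def
proof (rule cSUP_upper)
  have "compact ((\<lambda>z. norm (g z)) ` sphere 0 (norm z))"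
    using holomorphic_on_imp_continuous_on[OF assms]
    by (intro compact_continuous_image continuous_on_norm) (auto intro: continuous_on_subset)
  then show "bdd_above ((\<lambda>z. norm (g z)) ` sphere 0 (norm z))"
    by (simp add: bounded_imp_bdd_above compact_imp_bounded)
qed simp

lemma exp_bounded_of_ent_order_less:
  assumes hol: "g holomorphic_on UNIV" and order_less: "ent_order g < ereal \<tau>"
  shows "exp_bounded \<tau> at_infinity g"
proof -
  have "\<forall>\<^sub>F r in at_top. ereal (logp (logp (max_mod r g)) / ln r) < ereal \<tau>"
    using order_less unfolding ent_order_def by (rule Limsup_lessD)
  then have "\<forall>\<^sub>F r in at_top. max_mod r g \<le> exp (r powr \<tau>)"
    using eventually_gt_at_top[of 1]
  proof eventually_elim
    case (elim r)
    have "logp (max_mod r g) \<le> exp (logp (logp (max_mod r g)))" by (rule le_exp_logp)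
    also have "\<dots> \<le> exp (\<tau> * ln r)" using elim by (simp add: pos_divide_less_eq)
    also have "\<dots> = r powr \<tau>" using elim by (simp add: powr_def)
    finally show ?case using le_exp_logp[of "max_mod r g"] by (meson exp_le_cancel_iff order_trans)
  qed
  from eventually_norm_at_infinity[OF order_refl this]
  have "\<forall>\<^sub>F z in at_infinity. norm (g z) \<le> exp (1 * norm z powr \<tau>)"
    by eventually_elim (simp add: order_trans[OF norm_le_max_mod[OF hol]])
  then show ?thesis unfolding exp_bounded_def by blast
qed

lemma ent_order_le_of_exp_bounded:
  assumes "exp_bounded s at_infinity g" "s > 0"
  shows "ent_order g \<le> ereal s"
proof -
  obtain K where bound: "K > 0" "\<forall>\<^sub>F z in at_infinity. norm (g z) \<le> exp (K * norm z powr s)"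
    using exp_boundedE[OF assms(1)] .
  then obtain b where far: "\<And>z. b \<le> norm z \<Longrightarrow> norm (g z) \<le> exp (K * norm z powr s)"
    unfolding eventually_at_infinity by blast
  have "\<forall>\<^sub>F r in at_top. 1 < K * r powr s" using bound(1) assms(2) by real_asymp
  then have "\<forall>\<^sub>F r in at_top. ereal (logp (logp (max_mod r g)) / ln r)
      \<le> ereal ((ln K + s * ln r) / ln r)"
    using eventually_gt_at_top[of "max 1 b"]
  proof eventually_elim
    case (elim r)
    have "max_mod r g \<le> exp (K * r powr s)"
      unfolding max_mod_def
    proof (rule cSUP_least)
      show "sphere (0::complex) r \<noteq> {}" using elim by simp
      show "norm (g z) \<le> exp (K * r powr s)" if "z \<in> sphere 0 r" for z
        using far[of z] that elim by simp
    qed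
    then have "logp (max_mod r g) \<le> logp (exp (K * r powr s))" by (rule logp_mono)
    also have "\<dots> = K * r powr s" using elim by (simp add: logp_def)
    finally have "logp (logp (max_mod r g)) \<le> logp (K * r powr s)" by (rule logp_mono)
    also have "\<dots> = ln K + s * ln r" using elim bound(1) by (auto simp: logp_def ln_mult ln_powr)
    finally show ?case using elim by (simp add: divide_right_mono)
  qed
  then have "ent_order g \<le> Limsup at_top (\<lambda>r. ereal ((ln K + s * ln r) / ln r))"
    unfolding ent_order_def by (rule Limsup_mono)
  also have "\<dots> = ereal s"
  proof (rule lim_imp_Limsup)
    have "((\<lambda>r. (ln K + s * ln r) / ln r) \<longlongrightarrow> s) at_top" by real_asymp
    then show "((\<lambda>r. ereal ((ln K + s * ln r) / ln r)) \<longlongrightarrow> ereal s) at_top" by simp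
  qed simp
  finally show ?thesis .
qed

lemma ent_order_nonneg: "0 \<le> ent_order g"
  unfolding ent_order_def
proof (rule le_Limsup)
  show "\<forall>\<^sub>F r in at_top. 0 \<le> ereal (logp (logp (max_mod r g)) / ln r)"
    using eventually_gt_at_top[of 1]
    by eventually_elim (auto simp: logp_def intro!: divide_nonneg_nonneg)
qed simp

lemma ent_lower_order_le_ent_order: "ent_lower_order g \<le> ent_order g"
  unfolding ent_lower_order_def ent_order_def by (rule Liminf_le_Limsup) simp

section \<open>Exponentials of polynomials on rays\<close>

definition exp_indicator :: "complex poly \<Rightarrow> real \<Rightarrow> real" where
  "exp_indicator P \<theta> = Re (lead_coeff P * cis (real (degree P) * \<theta>))"

lemma exp_indicator_altdef:
  "exp_indicator P \<theta> = norm (lead_coeff P) * cos (Arg (lead_coeff P) + real (degree P) * \<theta>)"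
proof -
  have "lead_coeff P * cis (real (degree P) * \<theta>)
      = rcis (norm (lead_coeff P)) (Arg (lead_coeff P) + real (degree P) * \<theta>)"
    by (metis cis_rcis_eq mult.right_neutral rcis_cmod_Arg rcis_mult)
  then show ?thesis by (simp add: exp_indicator_def)
qed

lemma tendsto_Re_poly_ray:
  "((\<lambda>z. Re (poly P z) / norm z ^ degree P) \<longlongrightarrow> exp_indicator P \<theta>) (at_infinity_ray \<theta>)"
proof -
  let ?n = "degree P"
  have "((\<lambda>z. poly P z / z ^ ?n) \<longlongrightarrow> lead_coeff P) (at_infinity_ray \<theta>)"
    using poly_divide_tendsto_aux at_infinity_ray_le_at_infinity by (rule tendsto_mono[rotated])
  then have "((\<lambda>z. Re (poly P z / z ^ ?n * cis (real ?n * \<theta>))) \<longlongrightarrow> exp_indicator P \<theta>)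
      (at_infinity_ray \<theta>)"
    unfolding exp_indicator_def by (intro tendsto_intros)
  moreover have "\<forall>\<^sub>F z in at_infinity_ray \<theta>.
      Re (poly P z / z ^ ?n * cis (real ?n * \<theta>)) = Re (poly P z) / norm z ^ ?n"
    unfolding eventually_at_infinity_ray using eventually_gt_at_top[of 0]
  proof eventually_elim
    case (elim t)
    have "(rcis t \<theta>) ^ ?n = of_real (t ^ ?n) * cis (real ?n * \<theta>)"
      unfolding DeMoivre2 by (simp add: rcis_def)
    then have "poly P (rcis t \<theta>) / rcis t \<theta> ^ ?n * cis (real ?n * \<theta>)
        = poly P (rcis t \<theta>) / of_real (t ^ ?n)"
      by simp
    then show ?case using elim by (simp only: Re_divide_of_real) simp
  qed
  ultimately show ?thesis by (rule Lim_transform_eventually)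
qed

lemma exp_small_exp_poly:
  assumes "a * exp_indicator P \<theta> < 0" "degree P > 0"
  shows "exp_small (degree P) (at_infinity_ray \<theta>) (\<lambda>z. exp (of_real a * poly P z + k))"
proof -
  let ?n = "degree P"
  define L where "L = a * exp_indicator P \<theta>"
  have L_neg: "L < L / 2" using assms(1) by (simp add: L_def)
  have "((\<lambda>r. Re k / r ^ ?n) \<longlongrightarrow> 0) at_top" using assms(2) by real_asymp
  then have "((\<lambda>z. Re k / norm z ^ ?n) \<longlongrightarrow> 0) at_infinity"
    by (rule filterlim_compose[OF _ filterlim_norm_at_top])
  then have "((\<lambda>z. Re k / norm z ^ ?n) \<longlongrightarrow> 0) (at_infinity_ray \<theta>)"
    by (rule tendsto_mono[OF at_infinity_ray_le_at_infinity])
  with tendsto_Re_poly_ray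
  have "((\<lambda>z. a * (Re (poly P z) / norm z ^ ?n) + Re k / norm z ^ ?n) \<longlongrightarrow> L + 0) (at_infinity_ray \<theta>)"
    unfolding L_def by (intro tendsto_intros)
  then have "\<forall>\<^sub>F z in at_infinity_ray \<theta>.
      a * (Re (poly P z) / norm z ^ ?n) + Re k / norm z ^ ?n < L / 2"
    by (rule order_tendstoD) (use L_neg in simp)
  then have "\<forall>\<^sub>F z in at_infinity_ray \<theta>.
      norm (exp (of_real a * poly P z + k)) \<le> exp (- (- L / 2) * norm z powr ?n)"
    using eventually_norm_at_infinity[OF at_infinity_ray_le_at_infinity eventually_gt_at_top[of 0]]
  proof eventually_elim
    case (elim z)
    have "a * (Re (poly P z) / norm z ^ ?n) + Re k / norm z ^ ?n
        = Re (of_real a * poly P z + k) / norm z ^ ?n"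
      by (simp add: add_divide_distrib)
    then have "Re (of_real a * poly P z + k) < L / 2 * norm z ^ ?n"
      using elim by (simp add: pos_divide_less_eq)
    then show ?case using elim(2) by (simp add: powr_realpow)
  qed
  moreover have "- L / 2 > 0" using L_neg by simp
  ultimately show ?thesis unfolding exp_small_def by blast
qed

corollary exp_small_exp_poly_mult:
  fixes u :: "complex \<Rightarrow> complex"
  assumes "a * exp_indicator P \<theta> < 0" "exp_bounded s (at_infinity_ray \<theta>) u" "0 \<le> s" "s < degree P"
  shows "exp_small (degree P) (at_infinity_ray \<theta>) (\<lambda>z. exp (of_real a * poly P z + k) * u z)"
  using assms
  by (intro exp_small_mult_exp_bounded[OF at_infinity_ray_le_at_infinity exp_small_exp_poly]) auto

lemma continuous_on_exp_indicator: "continuous_on S (exp_indicator P)"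
  unfolding exp_indicator_altdef[abs_def] by (intro continuous_intros)

lemma open_exp_indicator_pos: "open {\<theta>. exp_indicator P \<theta> > 0}"
  and open_exp_indicator_nonzero: "open {\<theta>. exp_indicator P \<theta> \<noteq> 0}"
  by (intro open_Collect_less open_Collect_neq continuous_intros continuous_on_exp_indicator)+

lemma countable_exp_indicator_zeros:
  assumes "degree P > 0"
  shows "countable {\<theta>. exp_indicator P \<theta> = 0}"
proof (rule countable_subset)
  let ?\<phi> = "Arg (lead_coeff P)" and ?n = "real (degree P)"
  show "{\<theta>. exp_indicator P \<theta> = 0} \<subseteq> range (\<lambda>i::int. (of_int i * (pi / 2) - ?\<phi>) / ?n)"
  proof
    fix \<theta> assume "\<theta> \<in> {\<theta>. exp_indicator P \<theta> = 0}"
    moreover have "lead_coeff P \<noteq> 0" using assms by auto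
    ultimately obtain i :: int where "?\<phi> + ?n * \<theta> = of_int i * (pi / 2)"
      by (auto simp: exp_indicator_altdef cos_zero_iff_int)
    then have "\<theta> = (of_int i * (pi / 2) - ?\<phi>) / ?n" using assms by (simp add: field_simps)
    then show "\<theta> \<in> range (\<lambda>i::int. (of_int i * (pi / 2) - ?\<phi>) / ?n)" by blast
  qed
qed simp

lemma cos_pos_both_sides:
  fixes \<psi> e :: real
  assumes "e > 0"
  obtains a b where "a < \<psi>" "\<psi> < b" "b - a < pi + e" "cos a > 0" "cos b > 0"
proof (cases "cos \<psi> > 0")
  case True
  have "open {x. cos x > (0::real)}" by (intro open_Collect_less continuous_intros)
  then obtain d where near: "d > 0" "\<And>x. dist x \<psi> < d \<Longrightarrow> cos x > 0"
    using True unfolding open_dist by auto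
  define \<delta> where "\<delta> = min d 1 / 2"
  have "0 < \<delta>" "\<delta> < d" "\<delta> \<le> 1 / 2" using near(1) by (auto simp: \<delta>_def)
  then show ?thesis
    using that[of "\<psi> - \<delta>" "\<psi> + \<delta>"] near(2) pi_gt3 \<open>e > 0\<close> by (simp add: dist_real_def)
next
  case False
  define k where "k = \<lfloor>\<psi> / (2 * pi)\<rfloor>"
  define x where "x = \<psi> - of_int k * (2 * pi)"
  have "of_int k \<le> \<psi> / (2 * pi)" "\<psi> / (2 * pi) < of_int k + 1" unfolding k_def by linarith+
  then have x_range: "0 \<le> x" "x < 2 * pi" by (auto simp: x_def field_simps)
  have shift: "cos (y + of_int k * (2 * pi)) = cos y" for y
    using cos_int_2pin[of k] sin_int_2pin[of k] by (simp add: cos_add mult_ac)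
  have "cos x \<le> 0" using False shift[of x] by (simp add: x_def)
  then have x_bounds: "pi / 2 \<le> x" "x \<le> 3 / 2 * pi"
    using x_range cos_gt_zero_pi[of x] cos_gt_zero_pi[of "2 * pi - x"]
    by (auto simp: cos_2pi_minus not_less[symmetric])
  define d where "d = min 1 e / 3"
  have d_bounds: "d > 0" "2 * d < e" "d < pi / 2" using \<open>e > 0\<close> pi_gt3 by (auto simp: d_def)
  then have "sin d > 0" by (intro sin_gt_zero) auto
  then have "cos (pi / 2 - d) > 0" "cos (pi + (pi / 2 + d)) > 0"
    by (simp_all only: cos_periodic_pi2 cos_diff cos_add) simp_all
  then show ?thesis
    using that[of "pi / 2 - d + of_int k * (2 * pi)" "pi + (pi / 2 + d) + of_int k * (2 * pi)"]
      x_bounds d_bounds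
    unfolding shift by (simp add: x_def)
qed

lemma exp_indicator_pos_both_sides:
  assumes "degree P > 0" "e > 0"
  obtains \<theta>1 \<theta>2 where "\<theta>1 < \<theta>" "\<theta> < \<theta>2" "real (degree P) * (\<theta>2 - \<theta>1) < pi + e"
    "exp_indicator P \<theta>1 > 0" "exp_indicator P \<theta>2 > 0"
proof -
  let ?\<phi> = "Arg (lead_coeff P)" and ?n = "real (degree P)"
  obtain a b where sides: "a < ?\<phi> + ?n * \<theta>" "?\<phi> + ?n * \<theta> < b" "b - a < pi + e"
    "cos a > 0" "cos b > 0"
    using cos_pos_both_sides[OF \<open>e > 0\<close>] .
  have n_pos: "?n > 0" and "lead_coeff P \<noteq> 0" using assms(1) by auto
  show ?thesis
  proof
    show "(a - ?\<phi>) / ?n < \<theta>" "\<theta> < (b - ?\<phi>) / ?n"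
      using sides n_pos by (simp_all add: pos_divide_less_eq pos_less_divide_eq mult.commute)
    show "?n * ((b - ?\<phi>) / ?n - (a - ?\<phi>) / ?n) < pi + e"
      using sides(3) n_pos by (simp add: diff_divide_distrib[symmetric])
    show "exp_indicator P ((a - ?\<phi>) / ?n) > 0" "exp_indicator P ((b - ?\<phi>) / ?n) > 0"
      using sides n_pos \<open>lead_coeff P \<noteq> 0\<close> by (simp_all add: exp_indicator_altdef)
  qed
qed

section \<open>Linear differential equations on rays\<close>

lemma norm_le_powr_of_inner_derivative:
  fixes v v' :: "real \<Rightarrow> 'a::real_inner"
  assumes T_pos: "T > 0" and deriv: "\<And>t. t \<ge> T \<Longrightarrow> (v has_vector_derivative v' t) (at t)"
    and inner_le: "\<And>t. t \<ge> T \<Longrightarrow> v t \<bullet> v' t \<le> k / t * (norm (v t))\<^sup>2" and t_ge: "t \<ge> T"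
  shows "norm (v t) \<le> norm (v T) * (t / T) powr k"
proof -
  have "(v t \<bullet> v t) * t powr (- (2 * k)) \<le> (v T \<bullet> v T) * T powr (- (2 * k))"
  proof (rule DERIV_nonpos_imp_nonincreasing[OF t_ge])
    fix x assume x_range: "T \<le> x" "x \<le> t"
    then have x_pos: "x > 0" using T_pos by linarith
    have "((\<lambda>t. v t \<bullet> v t) has_derivative (\<lambda>h. v x \<bullet> (h *\<^sub>R v' x) + (h *\<^sub>R v' x) \<bullet> v x)) (at x)"
      using deriv[OF x_range(1)]
      by (intro has_derivative_inner) (simp_all add: has_vector_derivative_def)
    then have "((\<lambda>t. v t \<bullet> v t) has_real_derivative 2 * (v x \<bullet> v' x)) (at x)"
      by (rule has_derivative_imp_has_field_derivative) (simp add: inner_commute[of "v' x"])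
    then have "((\<lambda>t. (v t \<bullet> v t) * t powr (- (2 * k))) has_real_derivative
        2 * (v x \<bullet> v' x) * x powr (- (2 * k))
          + (- (2 * k) * x powr (- (2 * k) - 1)) * (v x \<bullet> v x)) (at x)"
      by (rule DERIV_mult[OF _ has_real_derivative_powr[OF x_pos]])
    also have "2 * (v x \<bullet> v' x) * x powr (- (2 * k))
          + (- (2 * k) * x powr (- (2 * k) - 1)) * (v x \<bullet> v x)
        = (v x \<bullet> v' x - k / x * (norm (v x))\<^sup>2) * (2 * x powr (- (2 * k)))"
      using x_pos by (simp add: powr_diff power2_norm_eq_inner algebra_simps)
    finally show "\<exists>y. ((\<lambda>t. (v t \<bullet> v t) * t powr (- (2 * k))) has_real_derivative y) (at x) \<and> y \<le> 0"
      using inner_le[OF x_range(1)] by (intro exI conjI) (assumption, simp add: mult_nonpos_nonneg)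
  qed
  moreover have "(v u \<bullet> v u) * u powr (- (2 * k)) = (norm (v u) / u powr k)\<^sup>2" if "u > 0" for u
  proof -
    have "u powr (2 * k) = (u powr k)\<^sup>2"
      unfolding power2_eq_square powr_add[symmetric] by (simp only: mult_2)
    then show ?thesis by (simp add: power2_norm_eq_inner power_divide powr_minus_divide)
  qed
  ultimately have "(norm (v t) / t powr k)\<^sup>2 \<le> (norm (v T) / T powr k)\<^sup>2"
    using T_pos t_ge by simp
  then have "norm (v t) / t powr k \<le> norm (v T) / T powr k"
    by (rule power2_le_imp_le) simp
  then show ?thesis using T_pos t_ge by (simp add: powr_divide pos_divide_le_eq)
qed

text \<open>The weight \<open>1 / t\<close> on \<open>y\<close> balances the two terms: it makes the growth rate of the system
  for \<open>(y', y / t)\<close> decay like \<open>1 / t\<close>, which gives polynomial instead of exponential growth.\<close>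

lemma inner_weighted_pair_le:
  fixes y y' y'' :: "'a::real_inner"
  assumes t_pos: "t > 0" and second_le: "norm y'' \<le> norm y' / t + norm y / t\<^sup>2"
  shows "(y', y /\<^sub>R t) \<bullet> (y'', y' /\<^sub>R t - y /\<^sub>R t\<^sup>2) \<le> 2 / t * (norm (y', y /\<^sub>R t))\<^sup>2"
proof -
  define a where "a = norm y'"
  define b where "b = norm y / t"
  have norm_y: "norm (y /\<^sub>R t) = b" using t_pos by (simp add: b_def divide_inverse_commute)
  have "y' \<bullet> y'' \<le> a * norm y''" unfolding a_def by (rule norm_cauchy_schwarz)
  also have "\<dots> \<le> a * ((a + b) / t)"
    using second_le
    by (intro mult_left_mono) (simp_all add: a_def b_def add_divide_distrib power2_eq_square)
  finally have "y' \<bullet> y'' \<le> a * ((a + b) / t)" .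
  moreover have "(y /\<^sub>R t) \<bullet> (y' /\<^sub>R t) \<le> b * (a / t)"
    using norm_cauchy_schwarz[of "y /\<^sub>R t" "y' /\<^sub>R t"] t_pos
    unfolding norm_y by (simp add: a_def divide_inverse_commute)
  moreover have "0 \<le> (y /\<^sub>R t) \<bullet> (y /\<^sub>R t\<^sup>2)" using t_pos by simp
  ultimately have "(y', y /\<^sub>R t) \<bullet> (y'', y' /\<^sub>R t - y /\<^sub>R t\<^sup>2) \<le> a * ((a + b) / t) + b * (a / t)"
    by (simp add: inner_diff_right)
  also have "\<dots> = (a\<^sup>2 + 2 * a * b) / t"
    by (simp add: add_divide_distrib power2_eq_square algebra_simps)
  also have "\<dots> \<le> (2 * (a\<^sup>2 + b\<^sup>2)) / t"
  proof (rule divide_right_mono)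
    have "0 \<le> (a - b)\<^sup>2 + b\<^sup>2" by simp
    then show "a\<^sup>2 + 2 * a * b \<le> 2 * (a\<^sup>2 + b\<^sup>2)" by (simp add: power2_diff)
  qed (use t_pos in simp)
  also have "\<dots> = 2 / t * (norm (y', y /\<^sub>R t))\<^sup>2"
    unfolding norm_Pair norm_y a_def[symmetric] by simp
  finally show ?thesis .
qed

lemma second_order_cubic_growth:
  fixes y y' y'' :: "real \<Rightarrow> 'a::real_inner"
  assumes T_pos: "T > 0"
    and deriv_y: "\<And>t. t \<ge> T \<Longrightarrow> (y has_vector_derivative y' t) (at t)"
    and deriv_y': "\<And>t. t \<ge> T \<Longrightarrow> (y' has_vector_derivative y'' t) (at t)"
    and second_le: "\<And>t. t \<ge> T \<Longrightarrow> norm (y'' t) \<le> norm (y' t) / t + norm (y t) / t\<^sup>2"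
  shows "\<exists>C. \<forall>t\<ge>T. norm (y t) \<le> C * t ^ 3"
proof -
  define v where "v t = (y' t, y t /\<^sub>R t)" for t
  define v' where "v' t = (y'' t, y' t /\<^sub>R t - y t /\<^sub>R t\<^sup>2)" for t
  have v_le: "norm (v t) \<le> norm (v T) * (t / T) powr 2" if "t \<ge> T" for t
  proof (rule norm_le_powr_of_inner_derivative[OF T_pos _ _ that])
    fix t assume t_ge: "t \<ge> T"
    then have t_pos: "t > 0" using T_pos by linarith
    have "((\<lambda>t. inverse t) has_real_derivative - (1 / t\<^sup>2)) (at t)"
      using t_pos by (auto intro!: derivative_eq_intros simp: power2_eq_square divide_inverse)
    then have "((\<lambda>t. y t /\<^sub>R t) has_vector_derivative
        (inverse t *\<^sub>R y' t + (- (1 / t\<^sup>2)) *\<^sub>R y t)) (at t)"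
      by (rule has_vector_derivative_scaleR[OF _ deriv_y[OF t_ge]])
    then show "(v has_vector_derivative v' t) (at t)"
      unfolding v_def[abs_def] v'_def
      using has_vector_derivative_Pair[OF deriv_y'[OF t_ge]] by (simp add: divide_inverse)
    show "v t \<bullet> v' t \<le> 2 / t * (norm (v t))\<^sup>2"
      unfolding v_def v'_def by (rule inner_weighted_pair_le[OF t_pos second_le[OF t_ge]])
  qed
  have "norm (y t) \<le> norm (v T) / T\<^sup>2 * t ^ 3" if t_ge: "t \<ge> T" for t
  proof -
    have t_pos: "t > 0" using T_pos t_ge by linarith
    have "norm (y t) / t \<le> norm (v t)"
      using norm_snd_le[of "y t /\<^sub>R t" "y' t"] t_pos by (simp add: v_def divide_inverse_commute)
    also have "\<dots> \<le> norm (v T) * (t / T)\<^sup>2" using v_le[OF t_ge] T_pos t_pos by simp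
    finally show ?thesis
      using t_pos by (simp add: pos_divide_le_eq power_divide power3_eq_cube power2_eq_square)
  qed
  then show ?thesis by blast
qed

lemma has_vector_derivative_along_ray:
  assumes "f holomorphic_on UNIV"
  shows "((\<lambda>t. f (rcis t \<theta>)) has_vector_derivative cis \<theta> * deriv f (rcis t \<theta>)) (at t)"
proof -
  have "(f has_field_derivative deriv f (rcis t \<theta>)) (at (rcis t \<theta>))"
    using assms by (simp add: holomorphic_derivI)
  moreover have "((\<lambda>t. rcis t \<theta>) has_vector_derivative cis \<theta>) (at t)"
    unfolding rcis_def by (auto intro!: derivative_eq_intros)
  ultimately show ?thesis
    using field_vector_diff_chain_at[of "\<lambda>t. rcis t \<theta>" "cis \<theta>" t f] by (simp add: o_def)
qed

lemma exp_bounded_second_order_on_ray: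
  fixes f A B :: "complex \<Rightarrow> complex"
  assumes hol: "f holomorphic_on UNIV" and "\<nu> > 0" "s > 0"
    and small: "exp_small \<nu> (at_infinity_ray \<theta>) A" "exp_small \<nu> (at_infinity_ray \<theta>) B"
    and equation: "\<forall>\<^sub>F z in at_infinity_ray \<theta>. deriv (deriv f) z = A z * deriv f z + B z * f z"
  shows "exp_bounded s (at_infinity_ray \<theta>) f"
proof -
  let ?z = "\<lambda>t. rcis t \<theta>"
  note le_inverse_power =
    exp_small_imp_eventually_le_inverse_power[OF at_infinity_ray_le_at_infinity _ \<open>\<nu> > 0\<close>]
  have hol_deriv: "deriv f holomorphic_on UNIV" using hol by (simp add: holomorphic_deriv)
  from equation le_inverse_power[OF small(1), of 1] le_inverse_power[OF small(2), of 2]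
  have "\<forall>\<^sub>F z in at_infinity_ray \<theta>.
      norm (deriv (deriv f) z) \<le> norm (deriv f z) / norm z + norm (f z) / (norm z)\<^sup>2"
  proof eventually_elim
    case (elim z)
    have "norm (deriv (deriv f) z) \<le> norm (A z) * norm (deriv f z) + norm (B z) * norm (f z)"
      using elim(1) norm_triangle_ineq[of "A z * deriv f z" "B z * f z"] by (simp add: norm_mult)
    also have "\<dots> \<le> 1 / norm z ^ 1 * norm (deriv f z) + 1 / norm z ^ 2 * norm (f z)"
      using elim(2,3) by (intro add_mono mult_right_mono) auto
    finally show ?case by simp
  qed
  then obtain T where second_le: "\<forall>t\<ge>T.
      norm (deriv (deriv f) (?z t)) \<le> norm (deriv f (?z t)) / \<bar>t\<bar> + norm (f (?z t)) / t\<^sup>2"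
    unfolding eventually_at_infinity_ray eventually_at_top_linorder by auto
  have curve_second_le: "norm (cis \<theta> * (cis \<theta> * deriv (deriv f) (?z t)))
      \<le> norm (cis \<theta> * deriv f (?z t)) / t + norm (f (?z t)) / t\<^sup>2" if "t \<ge> max T 1" for t
    using second_le[rule_format, of t] that by (simp add: norm_mult)
  have "((\<lambda>t. cis \<theta> * deriv f (?z t)) has_vector_derivative
      cis \<theta> * (cis \<theta> * deriv (deriv f) (?z t))) (at t)" for t
    by (rule has_vector_derivative_mult_right[OF has_vector_derivative_along_ray[OF hol_deriv]])
  moreover have "max T 1 > 0" by simp
  ultimately obtain C where cubic: "\<forall>t\<ge>max T 1. norm (f (?z t)) \<le> C * t ^ 3"
    using second_order_cubic_growth[OF _ has_vector_derivative_along_ray[OF hol] _ curve_second_le]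
    by blast
  have "\<forall>\<^sub>F z in at_infinity_ray \<theta>. norm (f z) \<le> C * norm z ^ 3"
    unfolding eventually_at_infinity_ray using eventually_ge_at_top[of "max T 1"]
  proof eventually_elim
    case (elim t)
    then show ?case using cubic by simp
  qed
  then show ?thesis
    by (rule exp_bounded_of_power_bound[OF at_infinity_ray_le_at_infinity _ \<open>s > 0\<close>])
qed

lemma not_exp_small_logarithmic_derivative:
  fixes F :: "complex \<Rightarrow> complex"
  assumes entire: "F holomorphic_on UNIV" "exp_bounded s at_infinity F" "0 < s" "s < \<nu>"
    and filter: "G \<le> at_infinity" "G \<noteq> bot"
    and sep: "poly_separated G ({z. F z = 0} \<union> {z. deriv F z = 0})"
    and nonzero: "deriv F z0 \<noteq> 0"
  shows "\<not> exp_small \<nu> G (\<lambda>z. deriv F z / F z)"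
proof
  assume small: "exp_small \<nu> G (\<lambda>z. deriv F z / F z)"
  obtain s' where between: "s < s'" "s' < \<nu>" using dense[OF entire(4)] by blast
  have "deriv F holomorphic_on UNIV" "exp_bounded s at_infinity (deriv F)"
    using entire by (simp_all add: holomorphic_deriv exp_bounded_deriv)
  from exp_bounded_inverse[OF this nonzero entire(3) filter(1) _ between(1)]
    poly_separated_mono[OF sep]
  have "exp_bounded s' G (\<lambda>z. inverse (deriv F z))" by simp
  moreover have "exp_bounded s' G F"
    using exp_bounded_filter_mono[OF entire(2) filter(1)] less_imp_le[OF between(1)]
    by (rule exp_bounded_exponent_mono[OF filter(1)])
  ultimately have "exp_small \<nu> G (\<lambda>z. deriv F z / F z * (inverse (deriv F z) * F z))"
    using between entire(3)
    by (intro exp_small_mult_exp_bounded[OF filter(1) small] exp_bounded_mult) auto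
  moreover have "\<forall>\<^sub>F z in G. norm (deriv F z / F z * (inverse (deriv F z) * F z))
      = norm (1 :: complex)"
    using eventually_not_in_of_poly_separated[OF sep filter(1)] by eventually_elim simp
  ultimately have "exp_small \<nu> G (\<lambda>z. 1 :: complex)" by (rule exp_small_transform_eventually)
  moreover have "0 < \<nu>" using entire(3,4) by simp
  ultimately show False using not_exp_small_one[OF filter] by blast
qed

section \<open>Solutions of finite order\<close>

locale finite_order_solution =
  fixes P :: "complex poly" and h1 h0 f :: "complex \<Rightarrow> complex"
    and c :: real and k :: complex and s1 s0 \<tau> :: real
  assumes degree_pos: "degree P > 0"
    and entire_h1: "h1 holomorphic_on UNIV" and bounded_h1: "exp_bounded s1 at_infinity h1"
    and nonzero_h1: "\<exists>z. h1 z \<noteq> 0"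
    and entire_h0: "h0 holomorphic_on UNIV" and bounded_h0: "exp_bounded s0 at_infinity h0"
    and entire_f: "f holomorphic_on UNIV" and bounded_f: "exp_bounded \<tau> at_infinity f"
    and nonconstant_f: "\<nexists>a. \<forall>z. f z = a"
    and exponents: "0 < s1" "s1 \<le> s0" "s0 < degree P" "1 \<le> \<tau>"
    and equation: "deriv (deriv f) z + h1 z * exp (of_real c * poly P z + k) * deriv f z
      + h0 z * exp (poly P z) * f z = 0"
begin

lemma deriv_quotient_eq:
  assumes "f z \<noteq> 0" "h1 z \<noteq> 0"
  shows "deriv f z / f z = - ((exp (of_real (- c) * poly P z + - k) * (deriv (deriv f) z / f z)
    + exp (of_real (1 - c) * poly P z + - k) * h0 z) * inverse (h1 z))"
proof -
  define E where "E = exp (of_real c * poly P z + k)"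
  have exp_eqs: "exp (of_real (- c) * poly P z + - k) = inverse E"
    "exp (of_real (1 - c) * poly P z + - k) = inverse E * exp (poly P z)"
    by (simp_all add: E_def exp_minus[symmetric] exp_add[symmetric] algebra_simps)
  have "E \<noteq> 0" by (simp add: E_def)
  moreover have "deriv (deriv f) z + exp (poly P z) * h0 z * f z = - (E * h1 z * deriv f z)"
    using equation[of z] unfolding E_def eq_neg_iff_add_eq_0 by (simp add: ac_simps)
  ultimately show ?thesis
    unfolding exp_eqs using assms by (simp add: field_simps)
qed

lemma h0_eq:
  assumes "c = 1" "f z \<noteq> 0"
  shows "h0 z = - (exp (- poly P z) * (deriv (deriv f) z / f z) + exp k * h1 z * (deriv f z / f z))"
proof -
  define E where "E = exp (poly P z)"
  have "E \<noteq> 0" by (simp add: E_def)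
  moreover have "deriv (deriv f) z + E * exp k * h1 z * deriv f z = - (E * h0 z * f z)"
    using equation[of z] assms(1) unfolding E_def eq_neg_iff_add_eq_0 by (simp add: exp_add ac_simps)
  moreover have exp_eq: "exp (- poly P z) = inverse E" by (simp add: E_def exp_minus)
  ultimately show ?thesis
    unfolding exp_eq using assms(2) by (simp add: field_simps)
qed

definition separated_ray :: "real \<Rightarrow> bool" where
  "separated_ray \<theta> \<longleftrightarrow>
     poly_separated (at_infinity_ray \<theta>) ({z. f z = 0} \<union> {z. deriv f z = 0} \<union> {z. h1 z = 0})"

lemma entire_bounded_deriv_f: "deriv f holomorphic_on UNIV" "exp_bounded \<tau> at_infinity (deriv f)"
  using entire_f bounded_f exponents by (simp_all add: holomorphic_deriv exp_bounded_deriv)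

lemma nonzero_f: "\<exists>z. f z \<noteq> 0"
  using nonconstant_f by blast

lemma nonzero_deriv_f: "\<exists>z. deriv f z \<noteq> 0"
proof (rule ccontr)
  assume "\<not> ?thesis"
  then have "(f has_field_derivative 0) (at z)" for z
    using holomorphic_derivI[OF entire_f open_UNIV, of z] by simp
  then have "\<exists>a. \<forall>z\<in>UNIV. f z = a" by (intro has_field_derivative_zero_constant) auto
  then show False using nonconstant_f by blast
qed

lemma ex_separated_ray_in_open:
  assumes "open U" "U \<noteq> {}"
  shows "\<exists>\<theta>\<in>U. separated_ray \<theta>"
proof -
  obtain z w v where "f z \<noteq> 0" "deriv f w \<noteq> 0" "h1 v \<noteq> 0"
    using nonzero_f nonzero_deriv_f nonzero_h1 by blast
  then have "poly_sparse ({z. f z = 0} \<union> {z. deriv f z = 0} \<union> {z. h1 z = 0})"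
    using exponents poly_sparse_zeros[OF entire_f bounded_f]
      poly_sparse_zeros[OF entire_bounded_deriv_f] poly_sparse_zeros[OF entire_h1 bounded_h1]
    by (intro poly_sparse_Un) auto
  then have "closure {\<theta>. separated_ray \<theta>} = UNIV"
    unfolding separated_ray_def by (rule closure_poly_separated_rays)
  then have "U \<inter> {\<theta>. separated_ray \<theta>} \<noteq> {}"
    using open_Int_closure_eq_empty[OF assms(1), of "{\<theta>. separated_ray \<theta>}"] assms(2) by simp
  then show ?thesis by auto
qed

context
  fixes \<theta>
  assumes sep: "separated_ray \<theta>"
begin

lemma poly_separated_zeros:
  "poly_separated (at_infinity_ray \<theta>) {z. f z = 0}"
  "poly_separated (at_infinity_ray \<theta>) {z. deriv f z = 0}"
  "poly_separated (at_infinity_ray \<theta>) {z. h1 z = 0}"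
  "poly_separated (at_infinity_ray \<theta>) ({z. f z = 0} \<union> {z. deriv f z = 0})"
  by (rule poly_separated_mono[OF sep[unfolded separated_ray_def]], blast)+

lemma eventually_nonzero: "\<forall>\<^sub>F z in at_infinity_ray \<theta>. f z \<noteq> 0 \<and> deriv f z \<noteq> 0 \<and> h1 z \<noteq> 0"
  using eventually_not_in_of_poly_separated
    [OF sep[unfolded separated_ray_def] at_infinity_ray_le_at_infinity] by simp

lemma exp_bounded_inverse_h1: "s1 < s \<Longrightarrow> exp_bounded s (at_infinity_ray \<theta>) (\<lambda>z. inverse (h1 z))"
  using nonzero_h1 exp_bounded_inverse
    [OF entire_h1 bounded_h1 _ exponents(1) at_infinity_ray_le_at_infinity poly_separated_zeros(3)]
  by blast

lemma exp_bounded_logarithmic_derivatives: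
  assumes "s > 0"
  shows "exp_bounded s (at_infinity_ray \<theta>) (\<lambda>z. deriv f z / f z)"
    and "exp_bounded s (at_infinity_ray \<theta>) (\<lambda>z. deriv (deriv f) z / deriv f z)"
  using exp_bounded_logarithmic_derivative
      [OF entire_f bounded_f _ _ at_infinity_ray_le_at_infinity poly_separated_zeros(1)]
    exp_bounded_logarithmic_derivative
      [OF entire_bounded_deriv_f _ _ at_infinity_ray_le_at_infinity poly_separated_zeros(2)]
    nonzero_f nonzero_deriv_f exponents assms by force+

lemma second_derivative_quotient_eq:
  "\<forall>\<^sub>F z in at_infinity_ray \<theta>.
     norm (deriv f z / f z * (deriv (deriv f) z / deriv f z)) = norm (deriv (deriv f) z / f z)"
  using eventually_nonzero by eventually_elim simp

lemma exp_bounded_second_derivative_quotient: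
  assumes "s > 0"
  shows "exp_bounded s (at_infinity_ray \<theta>) (\<lambda>z. deriv (deriv f) z / f z)"
  using exp_bounded_mult[OF exp_bounded_logarithmic_derivatives[OF assms]]
    second_derivative_quotient_eq
  by (rule exp_bounded_transform_eventually)

lemma exp_small_logarithmic_derivative:
  assumes "c > 1" "exp_indicator P \<theta> > 0"
  shows "exp_small (degree P) (at_infinity_ray \<theta>) (\<lambda>z. deriv f z / f z)"
proof -
  let ?R = "at_infinity_ray \<theta>" and ?n = "real (degree P)"
  define E1 where "E1 z = exp (of_real (- c) * poly P z + - k)" for z
  define E0 where "E0 z = exp (of_real (1 - c) * poly P z + - k)" for z
  obtain s where between: "s0 < s" "s < ?n" using dense[OF exponents(3)] by blast
  have pos: "0 < ?n" "0 < s" "s1 < s" using degree_pos between exponents by simp_all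
  note ray_le = at_infinity_ray_le_at_infinity[of \<theta>]
  have "exp_small ?n ?R (\<lambda>z. E1 z * (deriv (deriv f) z / f z))"
    unfolding E1_def using assms between pos
    by (intro exp_small_exp_poly_mult[OF _ exp_bounded_second_derivative_quotient])
      (simp_all add: mult_neg_pos)
  moreover have "exp_small ?n ?R (\<lambda>z. E0 z * h0 z)"
    unfolding E0_def using assms exponents
    by (intro exp_small_exp_poly_mult[OF _ exp_bounded_filter_mono[OF bounded_h0 ray_le]])
      (simp_all add: mult_neg_pos)
  ultimately have "exp_small ?n ?R (\<lambda>z. E1 z * (deriv (deriv f) z / f z) + E0 z * h0 z)"
    using pos(1) by (rule exp_small_add[OF ray_le])
  then have "exp_small ?n ?R
      (\<lambda>z. (E1 z * (deriv (deriv f) z / f z) + E0 z * h0 z) * inverse (h1 z))"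
    using between pos by (intro exp_small_mult_exp_bounded[OF ray_le _ exp_bounded_inverse_h1]) auto
  moreover have "\<forall>\<^sub>F z in ?R.
      norm ((E1 z * (deriv (deriv f) z / f z) + E0 z * h0 z) * inverse (h1 z))
        = norm (deriv f z / f z)"
    using eventually_nonzero
  proof eventually_elim
    case (elim z)
    then show ?case
      using deriv_quotient_eq[of z] unfolding E1_def E0_def by (metis norm_minus_cancel)
  qed
  ultimately show ?thesis by (rule exp_small_transform_eventually)
qed

lemma exp_small_second_derivative_quotient:
  assumes "c > 1" "exp_indicator P \<theta> > 0"
  shows "exp_small (degree P) (at_infinity_ray \<theta>) (\<lambda>z. deriv (deriv f) z / f z)"
proof -
  obtain s where between: "0 < s" "s < real (degree P)"
    using dense[of 0 "real (degree P)"] degree_pos by auto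
  have "exp_small (degree P) (at_infinity_ray \<theta>)
      (\<lambda>z. deriv f z / f z * (deriv (deriv f) z / deriv f z))"
    using between exp_bounded_logarithmic_derivatives(2) degree_pos
    by (intro exp_small_mult_exp_bounded[OF at_infinity_ray_le_at_infinity
          exp_small_logarithmic_derivative[OF assms]]) auto
  then show ?thesis using second_derivative_quotient_eq by (rule exp_small_transform_eventually)
qed

lemma exp_bounded_h0_on_ray:
  assumes "c = 1" "exp_indicator P \<theta> > 0"
  shows "exp_bounded s1 (at_infinity_ray \<theta>) h0"
proof -
  let ?R = "at_infinity_ray \<theta>"
  note ray_le = at_infinity_ray_le_at_infinity[of \<theta>]
  have "exp_small (degree P) ?R (\<lambda>z. exp (of_real (- 1) * poly P z + 0))"
    by (rule exp_small_exp_poly) (use assms degree_pos in simp_all)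
  then have bounded_exp: "exp_bounded s1 ?R (\<lambda>z. exp (- poly P z))"
    using exp_small_imp_exp_bounded[OF ray_le _ exponents(1)] by simp
  have "exp_bounded s1 ?R
      (\<lambda>z. exp (- poly P z) * (deriv (deriv f) z / f z) + exp k * h1 z * (deriv f z / f z))"
    using exponents bounded_exp exp_bounded_second_derivative_quotient
      exp_bounded_logarithmic_derivatives(1)
      exp_bounded_filter_mono[OF bounded_h1 ray_le]
    by (intro exp_bounded_add[OF ray_le] exp_bounded_mult
        exp_bounded_of_bounded[OF ray_le, of "\<lambda>_. exp k" "norm (exp k)"]) auto
  moreover have "\<forall>\<^sub>F z in ?R.
      norm (exp (- poly P z) * (deriv (deriv f) z / f z) + exp k * h1 z * (deriv f z / f z))
        = norm (h0 z)"
    using eventually_nonzero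
  proof eventually_elim
    case (elim z)
    then show ?case using h0_eq[OF assms(1), of z] by (metis norm_minus_cancel)
  qed
  ultimately show ?thesis by (rule exp_bounded_transform_eventually)
qed

end

text \<open>Where \<open>Re P > 0\<close>, the equation is read as \<open>f'' = (f'' / f) f\<close>, again with a small
  coefficient.\<close>

lemma exp_bounded_solution_on_ray:
  assumes c_gt_1: "c > 1" and sep: "separated_ray \<theta>" and indicator: "exp_indicator P \<theta> \<noteq> 0"
    and s_pos: "s > 0"
  shows "exp_bounded s (at_infinity_ray \<theta>) f"
proof (cases "exp_indicator P \<theta> > 0")
  case True
  have "\<forall>\<^sub>F z in at_infinity_ray \<theta>.
      deriv (deriv f) z = 0 * deriv f z + deriv (deriv f) z / f z * f z"
    using eventually_nonzero[OF sep] by eventually_elim simp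
  then show ?thesis
    using exp_small_second_derivative_quotient[OF sep c_gt_1 True] degree_pos s_pos
    by (intro exp_bounded_second_order_on_ray[OF entire_f _ _ exp_small_zero]) auto
next
  case False
  let ?R = "at_infinity_ray \<theta>" and ?n = "real (degree P)"
  note ray_le = at_infinity_ray_le_at_infinity[of \<theta>]
  have indicator_neg: "exp_indicator P \<theta> < 0" using False indicator by simp
  have small_h1: "exp_small ?n ?R (\<lambda>z. exp (of_real c * poly P z + k) * - h1 z)"
    using indicator_neg c_gt_1 exponents exp_bounded_filter_mono[OF bounded_h1 ray_le]
    by (intro exp_small_exp_poly_mult[of _ _ _ s1]) (simp_all add: mult_pos_neg)
  have small_h0: "exp_small ?n ?R (\<lambda>z. exp (of_real 1 * poly P z + 0) * - h0 z)"
    using indicator_neg exponents exp_bounded_filter_mono[OF bounded_h0 ray_le]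
    by (intro exp_small_exp_poly_mult[of _ _ _ s0]) simp_all
  have "deriv (deriv f) z = exp (of_real c * poly P z + k) * - h1 z * deriv f z
      + exp (of_real 1 * poly P z + 0) * - h0 z * f z" for z
    using equation by (simp add: algebra_simps eq_neg_iff_add_eq_0)
  then show ?thesis
    using degree_pos
    by (intro exp_bounded_second_order_on_ray[OF entire_f _ s_pos small_h1 small_h0]
        always_eventually) auto
qed

theorem exp_bounded_h0:
  assumes c_eq_1: "c = 1"
  shows "exp_bounded s1 at_infinity h0"
proof (rule exp_bounded_of_rays[OF entire_h0 bounded_h0 exponents(1,2)])
  fix \<theta>
  let ?n = "real (degree P)"
  have n_pos: "?n > 0" using degree_pos by simp
  have s0_pos: "s0 > 0" using exponents by linarith
  define e where "e = pi * (?n / s0 - 1)"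
  have e_pos: "e > 0" using exponents s0_pos by (simp add: e_def)
  obtain x1 x2 where sides: "x1 < \<theta>" "\<theta> < x2" "?n * (x2 - x1) < pi + e"
    "exp_indicator P x1 > 0" "exp_indicator P x2 > 0"
    using exp_indicator_pos_both_sides[OF degree_pos e_pos] .
  define d where "d = ((pi + e) / ?n - (x2 - x1)) / 2"
  have d_pos: "d > 0" using sides(3) n_pos by (simp add: d_def pos_less_divide_eq mult.commute)
  let ?pos = "{\<theta>. exp_indicator P \<theta> > 0}"
  note ex_ray =
    ex_separated_ray_in_open[OF open_Int[OF open_greaterThanLessThan open_exp_indicator_pos]]
  have "x1 \<in> {x1 - d<..<\<theta>} \<inter> ?pos" using sides d_pos by simp
  then obtain \<theta>1 where left_ray: "\<theta>1 \<in> {x1 - d<..<\<theta>} \<inter> ?pos" "separated_ray \<theta>1"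
    using ex_ray[of "x1 - d" \<theta> P] by blast
  have "x2 \<in> {\<theta><..<x2 + d} \<inter> ?pos" using sides d_pos by simp
  then obtain \<theta>2 where right_ray: "\<theta>2 \<in> {\<theta><..<x2 + d} \<inter> ?pos" "separated_ray \<theta>2"
    using ex_ray[of \<theta> "x2 + d" P] by blast
  have "\<theta>2 - \<theta>1 < x2 - x1 + 2 * d" using left_ray(1) right_ray(1) by auto
  also have "\<dots> = pi / s0" using s0_pos n_pos by (simp add: d_def e_def field_simps)
  finally have "s0 * (\<theta>2 - \<theta>1) < pi" using s0_pos by (simp add: pos_less_divide_eq mult.commute)
  then show "\<exists>\<theta>1 \<theta>2. \<theta>1 < \<theta> \<and> \<theta> < \<theta>2 \<and> s0 * (\<theta>2 - \<theta>1) < pi \<and>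
      exp_bounded s1 (at_infinity_ray \<theta>1) h0 \<and> exp_bounded s1 (at_infinity_ray \<theta>2) h0"
    using left_ray right_ray exp_bounded_h0_on_ray[OF _ c_eq_1] by auto
qed

lemma exp_bounded_half_solution:
  assumes c_gt_1: "c > 1"
  shows "exp_bounded (1 / 2) at_infinity f"
proof (rule exp_bounded_of_rays[OF entire_f bounded_f])
  fix \<theta>
  define d where "d = 1 / \<tau>"
  have d_props: "d > 0" "\<tau> * d = 1" using exponents by (simp_all add: d_def)
  have ex_ray: "\<exists>\<theta>\<in>{a<..<b}. exp_bounded (1 / 2) (at_infinity_ray \<theta>) f" if "a < b" for a b
  proof -
    have "\<exists>x\<in>{a<..<b}. x \<notin> {\<theta>. exp_indicator P \<theta> = 0}"
      using countable_exp_indicator_zeros[OF degree_pos] that by (intro open_minus_countable) auto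
    then have "\<exists>\<theta>\<in>{a<..<b} \<inter> {\<theta>. exp_indicator P \<theta> \<noteq> 0}. separated_ray \<theta>"
      by (intro ex_separated_ray_in_open open_Int open_greaterThanLessThan
          open_exp_indicator_nonzero) auto
    then obtain \<theta> where "\<theta> \<in> {a<..<b}" "exp_indicator P \<theta> \<noteq> 0" "separated_ray \<theta>" by blast
    then show ?thesis using exp_bounded_solution_on_ray[OF c_gt_1, of \<theta> "1 / 2"] by auto
  qed
  have "\<theta> - d < \<theta>" "\<theta> < \<theta> + d" using d_props by simp_all
  then obtain \<theta>1 \<theta>2 where left_ray: "\<theta>1 \<in> {\<theta> - d<..<\<theta>}" "exp_bounded (1 / 2) (at_infinity_ray \<theta>1) f"
    and right_ray: "\<theta>2 \<in> {\<theta><..<\<theta> + d}" "exp_bounded (1 / 2) (at_infinity_ray \<theta>2) f"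
    using ex_ray by meson
  have "\<tau> * (\<theta>2 - \<theta>1) \<le> \<tau> * (2 * d)"
    using left_ray(1) right_ray(1) exponents by (intro mult_left_mono) auto
  also have "\<dots> < pi" using d_props(2) pi_gt3 by simp
  finally show "\<exists>\<theta>1 \<theta>2. \<theta>1 < \<theta> \<and> \<theta> < \<theta>2 \<and> \<tau> * (\<theta>2 - \<theta>1) < pi \<and>
      exp_bounded (1 / 2) (at_infinity_ray \<theta>1) f \<and> exp_bounded (1 / 2) (at_infinity_ray \<theta>2) f"
    using left_ray right_ray by auto
qed (use exponents in auto)

theorem c_le_1: "c \<le> 1"
proof (rule ccontr)
  assume "\<not> c \<le> 1"
  then have c_gt_1: "c > 1" by simp
  obtain x where "exp_indicator P x > 0"
    using exp_indicator_pos_both_sides[OF degree_pos zero_less_one] .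
  then have "{\<theta>. exp_indicator P \<theta> > 0} \<noteq> {}" by auto
  then obtain \<theta> where ray: "exp_indicator P \<theta> > 0" "separated_ray \<theta>"
    using ex_separated_ray_in_open[OF open_exp_indicator_pos] by blast
  obtain z where "deriv f z \<noteq> 0" using nonzero_deriv_f by blast
  then have "\<not> exp_small (degree P) (at_infinity_ray \<theta>) (\<lambda>z. deriv f z / f z)"
    using degree_pos exp_bounded_half_solution[OF c_gt_1] poly_separated_zeros(4)[OF ray(2)]
    by (intro not_exp_small_logarithmic_derivative
        [OF entire_f _ _ _ at_infinity_ray_le_at_infinity]) auto
  then show False using exp_small_logarithmic_derivative[OF ray(2) c_gt_1 ray(1)] by contradiction
qed

end

theorem theorem4:
  fixes P1 P0 :: "complex poly" and h1 h0 f :: "complex \<Rightarrow> complex" and n :: nat and c :: real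
  assumes "n \<ge> 1"
    and "degree P1 = n" and "degree P0 = n"
    and "h1 holomorphic_on UNIV" and "h0 holomorphic_on UNIV"
    and "\<exists>z. h1 z \<noteq> 0" and "\<exists>z. h0 z \<noteq> 0"
    and "ent_order h1 < ereal (real (degree P1))"
    and "ent_order h0 < ereal (real (degree P0))"
    and "c \<ge> 1" and "degree (P1 - smult (complex_of_real c) P0) = 0"
    and "fabry_gaps h1"
    and "ent_lower_order h0 > ent_order h1"
    and "f holomorphic_on UNIV"
    and "\<forall>z. deriv (deriv f) z + h1 z * exp (poly P1 z) * deriv f z
              + h0 z * exp (poly P0 z) * f z = 0"
    and "\<not> (\<exists>a. \<forall>z. f z = a)"
  shows "ent_order f = \<infinity>"
proof (rule ccontr)
  assume "ent_order f \<noteq> \<infinity>"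
  then obtain m :: nat where "ent_order f < ereal (real m)" using less_PInf_Ex_of_nat by auto
  then have f_order: "ent_order f < ereal (real m + 1)" by (rule less_trans) simp
  have "ent_order h1 < ent_order h0"
    using assms(13) ent_lower_order_le_ent_order by (rule less_le_trans)
  then obtain s1 where s1_between: "ent_order h1 < ereal s1" "ereal s1 < ent_order h0"
    using ereal_dense2 by blast
  obtain s0 where s0_between: "ent_order h0 < ereal s0" "ereal s0 < ereal (real (degree P0))"
    using ereal_dense2[OF assms(9)] by blast
  have "0 < ereal s1" using ent_order_nonneg s1_between(1) by (rule le_less_trans)
  obtain k where difference: "P1 - smult (complex_of_real c) P0 = [:k:]"
    using assms(11) by (rule degree_eq_zeroE)
  have "poly P1 z = of_real c * poly P0 z + k" for z
    using arg_cong[OF difference, of "\<lambda>p. poly p z"] by (simp add: algebra_simps)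
  then interpret finite_order_solution P0 h1 h0 f c k s1 s0 "real m + 1"
    using assms f_order s1_between(1) s0_between \<open>0 < ereal s1\<close>
      less_trans[OF s1_between(2) s0_between(1)]
    by unfold_locales (auto intro: exp_bounded_of_ent_order_less)
  have "c = 1" using c_le_1 assms(10) by simp
  then have "ent_order h0 \<le> ereal s1"
    using exp_bounded_h0 exponents(1) by (intro ent_order_le_of_exp_bounded)
  then show False using s1_between(2) by simp
qed

end
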